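(* Let $K$ be an infinite field, let $m<n$ be positive integers, and set $d=\gcd(m,n)$. Let $T=(T_{ijk})_{1\le i\le m,\,1\le j\le n,\,1\le k\le 2}$ be an $m\times n\times 2$-tensor of independent indeterminates, $X=(T_{ij1})$, $Y=(T_{ij2})$, and let $G=\mathrm{SL}(m,K)\times\mathrm{SL}(n,K)$ act on $K[T]$ by $K$-algebra automorphisms such that $(P,Q)\in G$ sends $X$ to $P^\top XQ$ and $Y$ to $P^\top YQ$. (1) If $n=m+d$, then the determinant $$D=\left|\begin{array}{ccccc}X\\ Y&X\\ &Y&X\\ &&Y&\ddots\\ &&&\ddots&X\\ &&&&Y\end{array}\right|$$ of the $(mn/d)\times(mn/d)$ matrix described in the context is a sagbi basis of $K[T]^G$ (with respect to the monomial order specified in the context). In particular, $K[T]^G$ is generated by $D$ as a $K$-algebra. (2) If $n\neq m+d$, then $K[T]^G=K$.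
   Context: The matrix in (1) (for $n=m+d$) consists of $m/d$ block columns, each of $n$ columns, and $n/d=m/d+1$ block rows, each of $m$ rows; the $(p,p)$ block is $X$ and the $(p+1,p)$ block is $Y$ for $1\le p\le m/d$, and all other blocks are zero. The monomial order on $K[T]$ is the degree lexicographic order with $T_{111}>T_{211}>\cdots>T_{m11}>T_{121}>\cdots>T_{m21}>\cdots>T_{mn1}>T_{112}>T_{212}>\cdots>T_{m12}>T_{122}>\cdots>T_{mn2}$ (all $T_{ij1}$ are larger than all $T_{ij2}$, and for fixed $k$ the $T_{ijk}$ are ordered column by column, top to bottom within each column). $\mathrm{lm}(f)$ denotes the leading monomial of a nonzero polynomial $f$. A subset $F$ of a $K$-subalgebra $A$ of $K[T]$ is a sagbi basis of $A$ if the $K$-algebra generated by $\{\mathrm{lm}(f): f\in A, f\neq 0\}$ is generated by $\{\mathrm{lm}(f): f\in F\}$; that an element $D$ is a sagbi basis means that $\{D\}$ is one. *)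

theory Defs
  imports "HOL-Library.Poly_Mapping" "Jordan_Normal_Form.Determinant"
begin

text \<open>
  The indeterminates are labelled by triples \<open>(i, j, k)\<close>, counted from 0 to agree with the
  matrix library: \<open>(i, j, k)\<close> with \<open>i < m\<close>, \<open>j < n\<close>, \<open>k < 2\<close> stands for
  \<open>T\<^sub>i\<^sub>+\<^sub>1\<^sub>,\<^sub>j\<^sub>+\<^sub>1\<^sub>,\<^sub>k\<^sub>+\<^sub>1\<close>. Polynomials are finitely supported functions on exponent vectors, with the
  convolution product. This type has indeterminates for all triples; \<open>tensor_ring m n\<close> is the
  polynomial ring \<open>K[T]\<close> inside it.
\<close>

type_synonym tvar = "nat \<times> nat \<times> nat"
type_synonym tmonom = "tvar \<Rightarrow>\<^sub>0 nat"
type_synonym 'a tpoly = "tmonom \<Rightarrow>\<^sub>0 'a"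

definition tconst :: "'a::zero \<Rightarrow> 'a tpoly" where
  "tconst c = Poly_Mapping.single 0 c"

definition tmonomial :: "tmonom \<Rightarrow> 'a::comm_ring_1 tpoly" where
  "tmonomial t = Poly_Mapping.single t 1"

definition tindet :: "tvar \<Rightarrow> 'a::comm_ring_1 tpoly" where
  "tindet v = tmonomial (Poly_Mapping.single v 1)"

definition tensor_vars :: "nat \<Rightarrow> nat \<Rightarrow> tvar set" where
  "tensor_vars m n = {(i, j, k). i < m \<and> j < n \<and> k < 2}"

definition tensor_ring :: "nat \<Rightarrow> nat \<Rightarrow> 'a::comm_ring_1 tpoly set" where
  "tensor_ring m n = {f. \<forall>t \<in> Poly_Mapping.keys f. Poly_Mapping.keys t \<subseteq> tensor_vars m n}"

text \<open>The slices of the tensor: \<open>X\<close> is \<open>tslice m n 0\<close> and \<open>Y\<close> is \<open>tslice m n 1\<close>.\<close>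

definition tslice :: "nat \<Rightarrow> nat \<Rightarrow> nat \<Rightarrow> 'a::comm_ring_1 tpoly mat" where
  "tslice m n k = mat m n (\<lambda>(i, j). tindet (i, j, k))"

subsection \<open>The action and its invariants\<close>

text \<open>The \<open>K\<close>-algebra homomorphism that sends the indeterminate \<open>v\<close> to \<open>\<sigma> v\<close>.\<close>

definition tsubst :: "(tvar \<Rightarrow> 'a tpoly) \<Rightarrow> 'a tpoly \<Rightarrow> 'a::comm_ring_1 tpoly" where
  "tsubst \<sigma> f = (\<Sum>t \<in> Poly_Mapping.keys f. tconst (Poly_Mapping.lookup f t) *
     (\<Prod>v \<in> Poly_Mapping.keys t. \<sigma> v ^ Poly_Mapping.lookup t v))"

definition SL :: "nat \<Rightarrow> 'a::comm_ring_1 mat set" where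
  "SL n = {P \<in> carrier_mat n n. det P = 1}"

text \<open>Only the values on \<open>tensor_ring m n\<close> matter: for labels outside \<open>tensor_vars m n\<close> the
  matrix entry below is arbitrary.\<close>

definition tensor_act ::
  "nat \<Rightarrow> nat \<Rightarrow> 'a::comm_ring_1 mat \<Rightarrow> 'a mat \<Rightarrow> 'a tpoly \<Rightarrow> 'a tpoly" where
  "tensor_act m n P Q = tsubst (\<lambda>(i, j, k).
     (transpose_mat (map_mat tconst P) * tslice m n k * map_mat tconst Q) $$ (i, j))"

definition tensor_invariants :: "nat \<Rightarrow> nat \<Rightarrow> 'a::comm_ring_1 tpoly set" where
  "tensor_invariants m n =
     {f \<in> tensor_ring m n. \<forall>P \<in> SL m. \<forall>Q \<in> SL n. tensor_act m n P Q f = f}"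

subsection \<open>Leading monomials and sagbi bases\<close>

text \<open>\<open>tvar_less v w\<close> means that the indeterminate \<open>v\<close> is smaller than \<open>w\<close>; larger labels give
  smaller indeterminates.\<close>

definition tvar_less :: "tvar \<Rightarrow> tvar \<Rightarrow> bool" where
  "tvar_less = (\<lambda>(i, j, k) (i', j', k').
     k' < k \<or> k' = k \<and> (j' < j \<or> j' = j \<and> i' < i))"

definition tmonom_degree :: "tmonom \<Rightarrow> nat" where
  "tmonom_degree t = (\<Sum>v \<in> Poly_Mapping.keys t. Poly_Mapping.lookup t v)"

definition deglex_less :: "tmonom \<Rightarrow> tmonom \<Rightarrow> bool" where
  "deglex_less s t \<longleftrightarrow> tmonom_degree s < tmonom_degree t \<or>
     tmonom_degree s = tmonom_degree t \<and>
     (\<exists>v. Poly_Mapping.lookup s v < Poly_Mapping.lookup t v \<and>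
          (\<forall>w. tvar_less v w \<longrightarrow> Poly_Mapping.lookup s w = Poly_Mapping.lookup t w))"

text \<open>Meaningful for \<open>f \<noteq> 0\<close> only.\<close>

definition leading_monom :: "'a::zero tpoly \<Rightarrow> tmonom" where
  "leading_monom f = (THE t. t \<in> Poly_Mapping.keys f \<and>
     (\<forall>s \<in> Poly_Mapping.keys f. s \<noteq> t \<longrightarrow> deglex_less s t))"

definition lm :: "'a::comm_ring_1 tpoly \<Rightarrow> 'a tpoly" where
  "lm f = tmonomial (leading_monom f)"

definition is_subalgebra :: "'a::comm_ring_1 tpoly set \<Rightarrow> bool" where
  "is_subalgebra A \<longleftrightarrow> range tconst \<subseteq> A \<and> (\<forall>f \<in> A. \<forall>g \<in> A. f + g \<in> A \<and> f * g \<in> A)"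

definition generated_algebra :: "'a::comm_ring_1 tpoly set \<Rightarrow> 'a tpoly set" where
  "generated_algebra S = is_subalgebra hull S"

text \<open>Members of a sagbi basis are nonzero, since they must have leading monomials.\<close>

definition is_sagbi_basis :: "'a::comm_ring_1 tpoly set \<Rightarrow> 'a tpoly set \<Rightarrow> bool" where
  "is_sagbi_basis F A \<longleftrightarrow> is_subalgebra A \<and> F \<subseteq> A \<and> 0 \<notin> F \<and>
     generated_algebra (lm ` {f \<in> A. f \<noteq> 0}) = generated_algebra (lm ` F)"

subsection \<open>The block determinant\<close>

text \<open>Row \<open>r\<close> lies in block row \<open>r div m\<close>, column \<open>c\<close> in block column \<open>c div n\<close>. The matrix is
  square of size \<open>m * n div d\<close> when \<open>d\<close> divides \<open>m\<close> and \<open>n\<close>.\<close>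

definition tensor_block_mat :: "nat \<Rightarrow> nat \<Rightarrow> nat \<Rightarrow> 'a::comm_ring_1 tpoly mat" where
  "tensor_block_mat m n d = mat (n div d * m) (m div d * n) (\<lambda>(r, c).
     if r div m = c div n then tslice m n 0 $$ (r mod m, c mod n)
     else if r div m = c div n + 1 then tslice m n 1 $$ (r mod m, c mod n)
     else 0)"

definition tensor_block_det :: "nat \<Rightarrow> nat \<Rightarrow> nat \<Rightarrow> 'a::comm_ring_1 tpoly" where
  "tensor_block_det m n d = det (tensor_block_mat m n d)"

end

theory Submission
  imports Defs "Jordan_Normal_Form.Char_Poly"
begin

text \<open>
  Put \<open>e = n - m\<close>. A generic pencil \<open>(X, Y)\<close> is equivalent under \<open>GL(m) \<times> GL(n)\<close> to the shift pencil
  \<open>X = (I | 0)\<close>, \<open>Y = (0 | I)\<close>. This is proved by induction on \<open>m\<close>, reducing size \<open>m \<times> (m + e)\<close> to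
  \<open>(m - e) \<times> m\<close>; instead of the Zariski topology it suffices to use that a polynomial that vanishes at
  infinitely many points of a line vanishes on the line. A homogeneous invariant \<open>f\<close> of degree \<open>N\<close> is a
  semi-invariant of \<open>GL(m) \<times> GL(n)\<close> with character \<open>det(P)^(N/m) det(Q)^(N/n)\<close>, and \<open>m\<close>, \<open>n\<close> divide \<open>N\<close>
  when \<open>f \<noteq> 0\<close>. Hence \<open>f\<close> is determined by \<open>N\<close> and its value at the shift pencil.

  If \<open>n = m + d\<close>, then \<open>N\<close> is a multiple \<open>i * (m * n / d)\<close> of the degree of \<open>D\<close>, and \<open>D\<close> does not vanish at
  the shift pencil, so \<open>f\<close> is a scalar multiple of \<open>D^i\<close>. As \<open>D\<close> is homogeneous of positive degree, every
  leading monomial of an invariant is a power of that of \<open>D\<close>. If \<open>n \<noteq> m + d\<close>, then \<open>e\<close> does not divide \<open>m\<close>,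
  and the stabilizer of the shift pencil contains diagonal matrices (scaling the rows and columns whose
  index is divisible by \<open>e\<close>) on which the character is nontrivial unless \<open>N = 0\<close>.
\<close>

subsection \<open>Evaluation of polynomials\<close>

text \<open>Two obstacles shape the argument. An infinite field need not contain \<open>m\<close>-th
  roots, so an invertible matrix is in general no scalar multiple of one with determinant 1, and the
  character cannot be read off directly. It is found on diag(a, 1, ..., 1) with
  \<open>a = t ^ m\<close>, where the scalar \<open>t\<close> is available, and extended to all
  \<open>a\<close> by comparing polynomials in \<open>t\<close>; the same comparison yields the
  divisibility of \<open>N\<close>. Secondly, no generic pencil is ever named. The induction is
  about arbitrary sets \<open>Z\<close> of pencils that are closed under equivalence and along
  lines: if \<open>Z\<close> contains the shift pencil, it contains every pencil. The drop in size
  rests on the last \<open>e\<close> columns of \<open>shift_X\<close>, which vanish, so that adding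
  multiples of them to other columns changes only \<open>Y\<close>. Once \<open>Y\<close> is cleared
  outside an (m - e) by m block, this block is the second matrix of a smaller pencil, whose first
  matrix consists of the top m - e rows of the identity of size m.\<close>

definition monom_eval :: "(tvar \<Rightarrow> 'b::comm_ring_1) \<Rightarrow> tmonom \<Rightarrow> 'b" where
  "monom_eval \<sigma> t = (\<Prod>v\<in>Poly_Mapping.keys t. \<sigma> v ^ Poly_Mapping.lookup t v)"

text \<open>The coefficient map is a parameter so that one homomorphism theorem serves three uses:
  \<open>tconst\<close> gives the substitution \<open>tsubst\<close>, the identity gives the value
  at a point, and the constant polynomials give the restriction to a polynomial curve.\<close>

definition tpoly_eval ::
  "('a::comm_ring_1 \<Rightarrow> 'b::comm_ring_1) \<Rightarrow> (tvar \<Rightarrow> 'b) \<Rightarrow> 'a tpoly \<Rightarrow> 'b" where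
  "tpoly_eval \<phi> \<sigma> f =
     (\<Sum>t\<in>Poly_Mapping.keys f. \<phi> (Poly_Mapping.lookup f t) * monom_eval \<sigma> t)"

abbreviation tval :: "(tvar \<Rightarrow> 'a::comm_ring_1) \<Rightarrow> 'a tpoly \<Rightarrow> 'a" where
  "tval \<equiv> tpoly_eval (\<lambda>c. c)"

lemma monom_eval_superset:
  assumes "finite V" "Poly_Mapping.keys t \<subseteq> V"
  shows "monom_eval \<sigma> t = (\<Prod>v\<in>V. \<sigma> v ^ Poly_Mapping.lookup t v)"
  unfolding monom_eval_def using assms
  by (intro prod.mono_neutral_left) (auto simp: in_keys_iff)

lemma monom_eval_zero [simp]: "monom_eval \<sigma> 0 = 1"
  by (simp add: monom_eval_def)

lemma monom_eval_single [simp]: "monom_eval \<sigma> (Poly_Mapping.single v (Suc 0)) = \<sigma> v"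
  by (simp add: monom_eval_def)

lemma monom_eval_add: "monom_eval \<sigma> (s + t) = monom_eval \<sigma> s * monom_eval \<sigma> t"
proof -
  let ?V = "Poly_Mapping.keys s \<union> Poly_Mapping.keys t"
  have "Poly_Mapping.keys (s + t) \<subseteq> ?V" by (rule Poly_Mapping.keys_add)
  then show ?thesis
    by (simp add: monom_eval_superset[of ?V] lookup_add power_add prod.distrib)
qed

lemma tpoly_eval_superset:
  assumes "\<phi> 0 = 0" "finite S" "Poly_Mapping.keys f \<subseteq> S"
  shows "tpoly_eval \<phi> \<sigma> f = (\<Sum>t\<in>S. \<phi> (Poly_Mapping.lookup f t) * monom_eval \<sigma> t)"
  unfolding tpoly_eval_def using assms
  by (intro sum.mono_neutral_left) (auto simp: in_keys_iff)

lemma tpoly_expand: "f = (\<Sum>t\<in>Poly_Mapping.keys f. Poly_Mapping.single t (Poly_Mapping.lookup f t))"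
  by (rule poly_mapping_eqI)
    (auto simp: lookup_sum lookup_single when_def in_keys_iff)

lemma comm_ring_hom_tpoly_eval:
  assumes "comm_ring_hom \<phi>"
  shows "comm_ring_hom (tpoly_eval \<phi> \<sigma>)"
proof -
  interpret \<phi>: comm_ring_hom \<phi> by fact
  have single: "tpoly_eval \<phi> \<sigma> (Poly_Mapping.single t c) = \<phi> c * monom_eval \<sigma> t" for t c
    by (subst tpoly_eval_superset[of _ "{t}"]) auto
  have zero: "tpoly_eval \<phi> \<sigma> 0 = 0" by (simp add: tpoly_eval_def)
  have add: "tpoly_eval \<phi> \<sigma> (f + g) = tpoly_eval \<phi> \<sigma> f + tpoly_eval \<phi> \<sigma> g" for f g
  proof -
    let ?S = "Poly_Mapping.keys f \<union> Poly_Mapping.keys g"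
    have "Poly_Mapping.keys (f + g) \<subseteq> ?S" by (rule Poly_Mapping.keys_add)
    then show ?thesis
      by (simp add: tpoly_eval_superset[of _ ?S] lookup_add \<phi>.hom_add distrib_right sum.distrib)
  qed
  have sum: "tpoly_eval \<phi> \<sigma> (\<Sum>i\<in>I. g i) = (\<Sum>i\<in>I. tpoly_eval \<phi> \<sigma> (g i))"
    for g :: "tmonom \<Rightarrow> 'a tpoly" and I
    by (induction I rule: infinite_finite_induct) (auto simp: zero add)
  have mult: "tpoly_eval \<phi> \<sigma> (f * g) = tpoly_eval \<phi> \<sigma> f * tpoly_eval \<phi> \<sigma> g" for f g
  proof -
    have "f * g = (\<Sum>s\<in>Poly_Mapping.keys f. \<Sum>t\<in>Poly_Mapping.keys g.
        Poly_Mapping.single (s + t) (Poly_Mapping.lookup f s * Poly_Mapping.lookup g t))"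
      by (subst tpoly_expand[of f], subst tpoly_expand[of g]) (simp add: sum_product mult_single)
    then have "tpoly_eval \<phi> \<sigma> (f * g) = (\<Sum>s\<in>Poly_Mapping.keys f. \<Sum>t\<in>Poly_Mapping.keys g.
        \<phi> (Poly_Mapping.lookup f s * Poly_Mapping.lookup g t) * monom_eval \<sigma> (s + t))"
      by (simp only: sum single)
    then show ?thesis
      by (simp add: \<phi>.hom_mult monom_eval_add tpoly_eval_def sum_product mult_ac)
  qed
  show ?thesis
    by unfold_locales (auto simp: zero add mult single simp flip: single_one)
qed

lemma comm_ring_hom_ident: "comm_ring_hom (\<lambda>c. c)"
  by unfold_locales auto

lemma comm_ring_hom_poly: "comm_ring_hom (\<lambda>p::'a::comm_ring_1 poly. poly p a)"
  by unfold_locales auto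

lemma tsubst_eq_tpoly_eval: "tsubst = tpoly_eval tconst"
  by (intro ext) (simp add: tsubst_def tpoly_eval_def monom_eval_def)

lemma tpoly_eval_cong:
  assumes "\<And>t v. t \<in> Poly_Mapping.keys f \<Longrightarrow> v \<in> Poly_Mapping.keys t \<Longrightarrow> \<sigma> v = \<tau> v"
  shows "tpoly_eval \<phi> \<sigma> f = tpoly_eval \<phi> \<tau> f"
  unfolding tpoly_eval_def monom_eval_def
  by (intro sum.cong refl arg_cong2[of _ _ _ _ "(*)"] prod.cong) (auto simp: assms)

lemma hom_tpoly_eval:
  assumes "comm_ring_hom \<psi>"
  shows "\<psi> (tpoly_eval \<phi> \<sigma> f) = tpoly_eval (\<psi> \<circ> \<phi>) (\<psi> \<circ> \<sigma>) f"
proof -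
  interpret \<psi>: comm_ring_hom \<psi> by fact
  show ?thesis
    by (simp add: tpoly_eval_def monom_eval_def \<psi>.hom_sum \<psi>.hom_mult \<psi>.hom_prod \<psi>.hom_power)
qed

interpretation tval: comm_ring_hom "tval x"
  by (rule comm_ring_hom_tpoly_eval[OF comm_ring_hom_ident])

lemma tval_tconst [simp]: "tval x (tconst c) = c"
  unfolding tconst_def by (subst tpoly_eval_superset[of _ "{0}"]) auto

lemma tval_tindet [simp]: "tval x (tindet v) = x v"
  unfolding tindet_def tmonomial_def
  by (subst tpoly_eval_superset[of _ "{Poly_Mapping.single v 1}"]) auto

lemma tval_tsubst: "tval x (tsubst \<sigma> f) = tval (\<lambda>v. tval x (\<sigma> v)) f"
  unfolding tsubst_eq_tpoly_eval
  by (subst hom_tpoly_eval[OF tval.comm_ring_hom_axioms]) (simp add: o_def)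

lemma tval_polynomial_path:
  "\<exists>p. \<forall>t. poly p t = tval (\<lambda>v. poly (q v) t) f" for f :: "'a::comm_ring_1 tpoly"
proof (intro exI allI)
  fix t
  show "poly (tpoly_eval (\<lambda>c. [:c:]) q f) t = tval (\<lambda>v. poly (q v) t) f"
    by (subst hom_tpoly_eval[OF comm_ring_hom_poly]) (simp add: o_def)
qed

section \<open>Polynomials over an infinite domain are determined by their values\<close>

lemma poly_eq_if_infinite_agree:
  fixes p q :: "'a::idom poly"
  assumes "infinite S" "\<And>t. t \<in> S \<Longrightarrow> poly p t = poly q t"
  shows "p = q"
proof (rule ccontr)
  assume "p \<noteq> q"
  then have "finite {t. poly (p - q) t = 0}" by (intro poly_roots_finite) simp
  then have "finite S" by (rule rev_finite_subset) (auto simp: assms(2))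
  with assms(1) show False by simp
qed

lemma coeffs_zero_if_infinite_zeros:
  fixes a :: "nat \<Rightarrow> 'a::idom"
  assumes "infinite (UNIV :: 'a set)" "\<And>t. (\<Sum>k\<le>N. a k * t ^ k) = 0" "k \<le> N"
  shows "a k = 0"
proof -
  have "(\<Sum>k\<le>N. Polynomial.monom (a k) k) = 0"
    by (rule poly_eq_if_infinite_agree[OF assms(1)]) (simp add: poly_sum poly_monom assms(2))
  from arg_cong[OF this, of "\<lambda>p. coeff p k"] show ?thesis
    using assms(3) by (simp add: coeff_sum sum.delta)
qed

text \<open>Induction on the number of indeterminates. Instead of polynomials in \<open>V\<close>,
  the statement speaks of a finite set \<open>S\<close> of exponent vectors that \<open>V\<close>
  tells apart. The vectors with a fixed exponent of the new indeterminate \<open>v\<close> are then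
  told apart by the old ones alone, and the induction hypothesis applies to them unchanged.\<close>

lemma coeffs_zero_if_vanishing_aux:
  fixes c :: "tmonom \<Rightarrow> 'a::idom"
  assumes inf: "infinite (UNIV :: 'a set)" and "finite V"
  shows "\<lbrakk>finite S; \<And>s t. s \<in> S \<Longrightarrow> t \<in> S \<Longrightarrow>
            (\<And>v. v \<in> V \<Longrightarrow> Poly_Mapping.lookup s v = Poly_Mapping.lookup t v) \<Longrightarrow> s = t;
          \<And>x. (\<Sum>t\<in>S. c t * (\<Prod>v\<in>V. x v ^ Poly_Mapping.lookup t v)) = 0; t \<in> S\<rbrakk> \<Longrightarrow> c t = 0"
  using \<open>finite V\<close>
proof (induction V arbitrary: S t rule: finite_induct)
  case empty
  then have "S = {t}" by auto
  with empty.prems(3) show ?case by simp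
next
  case (insert v V)
  define N where "N = Max ((\<lambda>t. Poly_Mapping.lookup t v) ` S)"
  have le: "Poly_Mapping.lookup s v \<le> N" if "s \<in> S" for s
    using insert.prems(1) that by (simp add: N_def)
  define T where "T k = {s \<in> S. Poly_Mapping.lookup s v = k}" for k
  let ?k = "Poly_Mapping.lookup t v"
  show ?case
  proof (rule insert.IH[of "T ?k" t])
    show "finite (T ?k)" "t \<in> T ?k"
      using insert.prems by (auto simp: T_def)
    show "s = u" if "s \<in> T ?k" "u \<in> T ?k"
      "\<And>w. w \<in> V \<Longrightarrow> Poly_Mapping.lookup s w = Poly_Mapping.lookup u w" for s u
      by (rule insert.prems(2)) (use that in \<open>auto simp: T_def\<close>)
    fix x
    let ?g = "\<lambda>t. c t * (\<Prod>v\<in>V. x v ^ Poly_Mapping.lookup t v)"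
    \<comment> \<open>With the other indeterminates fixed, the given sum is a polynomial in the
      value \<open>a\<close> of \<open>v\<close>; its coefficients are the sums over the slices
      \<open>T k\<close>.\<close>
    have "(\<Sum>k\<le>N. (\<Sum>t\<in>T k. ?g t) * a ^ k) = 0" for a
    proof -
      have "(\<Sum>k\<le>N. (\<Sum>t\<in>T k. ?g t) * a ^ k) =
          (\<Sum>k\<le>N. \<Sum>t\<in>T k. ?g t * a ^ Poly_Mapping.lookup t v)"
        by (simp add: sum_distrib_right T_def)
      also have "\<dots> = (\<Sum>t\<in>S. ?g t * a ^ Poly_Mapping.lookup t v)"
        unfolding T_def using insert.prems(1) le by (intro sum.group) auto
      also have "\<dots> = (\<Sum>t\<in>S. c t * (\<Prod>w\<in>insert v V. (x(v := a)) w ^ Poly_Mapping.lookup t w))"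
      proof (rule sum.cong[OF refl])
        fix t
        have "(\<Prod>w\<in>V. (x(v := a)) w ^ Poly_Mapping.lookup t w) = (\<Prod>w\<in>V. x w ^ Poly_Mapping.lookup t w)"
          using insert.hyps by (intro prod.cong) auto
        then show "?g t * a ^ Poly_Mapping.lookup t v =
            c t * (\<Prod>w\<in>insert v V. (x(v := a)) w ^ Poly_Mapping.lookup t w)"
          using insert.hyps by (simp add: mult_ac)
      qed
      also have "\<dots> = 0" by (rule insert.prems(3))
      finally show ?thesis .
    qed
    from coeffs_zero_if_infinite_zeros[OF inf this, of ?k] le[OF insert.prems(4)]
    show "(\<Sum>t\<in>T ?k. ?g t) = 0" by simp
  qed
qed

lemma tpoly_zero_if_vanishing:
  fixes f :: "'a::idom tpoly"
  assumes inf: "infinite (UNIV :: 'a set)" and van: "\<And>x. tval x f = 0"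
  shows "f = 0"
proof (rule poly_mapping_eqI)
  fix t
  let ?V = "\<Union>t\<in>Poly_Mapping.keys f. Poly_Mapping.keys t"
  have "Poly_Mapping.lookup f t = 0" if t: "t \<in> Poly_Mapping.keys f"
  proof (rule coeffs_zero_if_vanishing_aux[OF inf, of ?V "Poly_Mapping.keys f"])
    show "s = u" if "s \<in> Poly_Mapping.keys f" "u \<in> Poly_Mapping.keys f"
      "\<And>v. v \<in> ?V \<Longrightarrow> Poly_Mapping.lookup s v = Poly_Mapping.lookup u v" for s u
    proof (rule poly_mapping_eqI)
      fix v
      show "Poly_Mapping.lookup s v = Poly_Mapping.lookup u v"
      proof (cases "v \<in> ?V")
        case False
        with that have "v \<notin> Poly_Mapping.keys s" "v \<notin> Poly_Mapping.keys u" by blast+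
        then show ?thesis by (simp add: in_keys_iff)
      qed (use that in simp)
    qed
    show "(\<Sum>t\<in>Poly_Mapping.keys f. Poly_Mapping.lookup f t * (\<Prod>v\<in>?V. x v ^ Poly_Mapping.lookup t v)) = 0" for x
    proof -
      have "monom_eval x t = (\<Prod>v\<in>?V. x v ^ Poly_Mapping.lookup t v)"
        if "t \<in> Poly_Mapping.keys f" for t
        using that by (intro monom_eval_superset) auto
      then show ?thesis using van[of x] by (simp add: tpoly_eval_def)
    qed
  qed (use t in auto)
  then show "Poly_Mapping.lookup f t = Poly_Mapping.lookup 0 t"
    by (auto simp: in_keys_iff)
qed

subsection \<open>Homogeneous components\<close>

definition hom_component :: "nat \<Rightarrow> 'a::comm_ring_1 tpoly \<Rightarrow> 'a tpoly" where
  "hom_component k f = (\<Sum>t | t \<in> Poly_Mapping.keys f \<and> tmonom_degree t = k.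
     Poly_Mapping.single t (Poly_Mapping.lookup f t))"

lemma lookup_hom_component:
  "Poly_Mapping.lookup (hom_component k f) t = (if tmonom_degree t = k then Poly_Mapping.lookup f t else 0)"
  by (auto simp: hom_component_def lookup_sum lookup_single when_def in_keys_iff)

lemma keys_hom_component:
  "Poly_Mapping.keys (hom_component k f) = {t \<in> Poly_Mapping.keys f. tmonom_degree t = k}"
  by (auto simp: in_keys_iff lookup_hom_component split: if_splits)

lemma monom_eval_scale:
  "monom_eval (\<lambda>v. a * x v) t = a ^ tmonom_degree t * monom_eval x t"
  by (simp add: monom_eval_def tmonom_degree_def power_mult_distrib prod.distrib power_sum)

lemma tval_hom_component_scale:
  "tval (\<lambda>v. a * x v) (hom_component k f) = a ^ k * tval x (hom_component k f)"
  unfolding tpoly_eval_def sum_distrib_left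
  by (intro sum.cong refl) (auto simp: monom_eval_scale keys_hom_component mult_ac)

text \<open>The bound may be enlarged at will; later sums must also reach a prescribed degree, or
  end at a multiple of the degree of \<open>D\<close>.\<close>

lemma tpoly_eq_sum_hom_components:
  fixes f :: "'a::comm_ring_1 tpoly"
  obtains N where "\<And>M. M \<ge> N \<Longrightarrow> f = (\<Sum>k\<le>M. hom_component k f)"
proof
  fix M assume M: "M \<ge> Max (insert 0 (tmonom_degree ` Poly_Mapping.keys f))"
  have "tmonom_degree t \<le> M" if "t \<in> Poly_Mapping.keys f" for t
    using M that by simp
  then show "f = (\<Sum>k\<le>M. hom_component k f)"
    by (intro poly_mapping_eqI)
      (force simp: lookup_sum lookup_hom_component sum.delta in_keys_iff not_le)
qed

text \<open>Along the ray through a point, \<open>f\<close> is a polynomial in \<open>a\<close>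
  whose coefficient of \<open>a ^ k\<close> is the value of the component of degree
  \<open>k\<close>. Comparing coefficients is how invariance of \<open>f\<close> passes to its
  components.\<close>

lemma tval_hom_component_eq_if_scale:
  fixes f :: "'a::idom tpoly"
  assumes inf: "infinite (UNIV :: 'a set)"
    and eq: "\<And>a. tval (\<lambda>v. a * x v) f = tval (\<lambda>v. a * y v) f"
  shows "tval x (hom_component k f) = tval y (hom_component k f)"
proof -
  obtain N where N: "\<And>M. M \<ge> N \<Longrightarrow> f = (\<Sum>k\<le>M. hom_component k f)"
    using tpoly_eq_sum_hom_components[of f] by blast
  define M where "M = max N k"
  have f: "f = (\<Sum>k\<le>M. hom_component k f)" by (rule N) (simp add: M_def)
  have expand: "tval (\<lambda>v. a * z v) f = (\<Sum>k\<le>M. tval z (hom_component k f) * a ^ k)" for a z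
    by (subst f) (simp add: tval.hom_sum tval_hom_component_scale mult.commute)
  have "tval x (hom_component k f) - tval y (hom_component k f) = 0"
    by (rule coeffs_zero_if_infinite_zeros[OF inf, where N = M])
      (use eq expand in \<open>auto simp: left_diff_distrib sum_subtractf M_def\<close>)
  then show ?thesis by simp
qed

subsection \<open>The monomial order\<close>

lemma tmonom_degree_add: "tmonom_degree (s + t) = tmonom_degree s + tmonom_degree t"
proof -
  let ?V = "Poly_Mapping.keys s \<union> Poly_Mapping.keys t"
  have deg: "tmonom_degree u = (\<Sum>v\<in>?V. Poly_Mapping.lookup u v)"
    if "Poly_Mapping.keys u \<subseteq> ?V" for u
    unfolding tmonom_degree_def using that
    by (intro sum.mono_neutral_left) (auto simp: in_keys_iff)
  show ?thesis
    using Poly_Mapping.keys_add[of s t] by (simp add: deg lookup_add sum.distrib)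
qed

lemma tvar_less_irrefl: "\<not> tvar_less v v"
  by (cases v) (simp add: tvar_less_def)

lemma tvar_less_trans: "tvar_less u v \<Longrightarrow> tvar_less v w \<Longrightarrow> tvar_less u w"
  by (cases u; cases v; cases w) (auto simp: tvar_less_def)

lemma tvar_less_total: "tvar_less v w \<or> v = w \<or> tvar_less w v"
  by (cases v; cases w) (auto simp: tvar_less_def)

lemma deglex_less_irrefl: "\<not> deglex_less s s"
  by (simp add: deglex_less_def)

text \<open>Among monomials of equal degree, the larger of the two deciding indeterminates decides
  the composite comparison.\<close>

lemma deglex_less_trans:
  assumes st: "deglex_less s t" and tu: "deglex_less t u"
  shows "deglex_less s u"
proof (cases "tmonom_degree s = tmonom_degree t \<and> tmonom_degree t = tmonom_degree u")
  case True
  from st True obtain v where v: "Poly_Mapping.lookup s v < Poly_Mapping.lookup t v"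
    "\<And>w. tvar_less v w \<Longrightarrow> Poly_Mapping.lookup s w = Poly_Mapping.lookup t w"
    by (auto simp: deglex_less_def)
  from tu True obtain v' where v': "Poly_Mapping.lookup t v' < Poly_Mapping.lookup u v'"
    "\<And>w. tvar_less v' w \<Longrightarrow> Poly_Mapping.lookup t w = Poly_Mapping.lookup u w"
    by (auto simp: deglex_less_def)
  consider "tvar_less v v'" | "v = v'" | "tvar_less v' v" using tvar_less_total by blast
  then have "\<exists>x. Poly_Mapping.lookup s x < Poly_Mapping.lookup u x \<and>
      (\<forall>w. tvar_less x w \<longrightarrow> Poly_Mapping.lookup s w = Poly_Mapping.lookup u w)"
  proof cases
    case 1
    then show ?thesis using v v' by (intro exI[of _ v']) (auto dest: tvar_less_trans)
  next
    case 2
    then show ?thesis using v v' by (intro exI[of _ v']) auto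
  next
    case 3
    then show ?thesis using v v' by (intro exI[of _ v]) (auto dest: tvar_less_trans)
  qed
  with True show ?thesis by (simp add: deglex_less_def)
qed (use assms in \<open>auto simp: deglex_less_def\<close>)

lemma deglex_less_asym: "deglex_less s t \<Longrightarrow> \<not> deglex_less t s"
  using deglex_less_trans deglex_less_irrefl by metis

lemma finite_has_tvar_greatest:
  assumes "finite V" "V \<noteq> {}"
  shows "\<exists>v\<in>V. \<forall>w\<in>V. \<not> tvar_less v w"
  using assms
proof (induction V rule: finite_ne_induct)
  case (singleton x)
  then show ?case by (simp add: tvar_less_irrefl)
next
  case (insert x V)
  then obtain v where v: "v \<in> V" "\<forall>w\<in>V. \<not> tvar_less v w" by blast
  show ?case
  proof (cases "tvar_less v x")
    case True
    with v have "\<forall>w\<in>insert x V. \<not> tvar_less x w"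
      using tvar_less_trans tvar_less_irrefl by blast
    then show ?thesis by blast
  qed (use v in blast)
qed

lemma deglex_less_total:
  assumes "s \<noteq> t"
  shows "deglex_less s t \<or> deglex_less t s"
proof (cases "tmonom_degree s = tmonom_degree t")
  case True
  let ?V = "{v. Poly_Mapping.lookup s v \<noteq> Poly_Mapping.lookup t v}"
  have "?V \<subseteq> Poly_Mapping.keys s \<union> Poly_Mapping.keys t"
    by (auto simp: in_keys_iff)
  then have "finite ?V" by (rule finite_subset) simp
  moreover have "?V \<noteq> {}" using assms poly_mapping_eqI[of s t] by auto
  ultimately obtain v where v: "v \<in> ?V" "\<forall>w\<in>?V. \<not> tvar_less v w"
    using finite_has_tvar_greatest by blast
  then have "\<forall>w. tvar_less v w \<longrightarrow> Poly_Mapping.lookup s w = Poly_Mapping.lookup t w" by blast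
  moreover have "Poly_Mapping.lookup s v < Poly_Mapping.lookup t v \<or>
      Poly_Mapping.lookup t v < Poly_Mapping.lookup s v" using v(1) by auto
  ultimately show ?thesis using True unfolding deglex_less_def by metis
qed (auto simp: deglex_less_def)

lemma deglex_less_add: "deglex_less s t \<Longrightarrow> deglex_less (s + u) (t + u)"
  by (auto simp: deglex_less_def tmonom_degree_add lookup_add)

subsection \<open>Leading monomials\<close>

text \<open>The condition under the description operator of \<open>leading_monom\<close>, made a
  predicate: by asymmetry of the order, exhibiting one monomial that satisfies it computes the
  leading monomial.\<close>

definition is_leading_monom :: "'a::zero tpoly \<Rightarrow> tmonom \<Rightarrow> bool" where
  "is_leading_monom f t \<longleftrightarrow> t \<in> Poly_Mapping.keys f \<and>
     (\<forall>s\<in>Poly_Mapping.keys f. s \<noteq> t \<longrightarrow> deglex_less s t)"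

lemma leading_monom_eqI: "is_leading_monom f t \<Longrightarrow> leading_monom f = t"
  unfolding leading_monom_def is_leading_monom_def
  by (rule the_equality) (blast, metis deglex_less_asym)

lemma is_leading_monom_leading_monom:
  assumes "f \<noteq> 0"
  shows "is_leading_monom f (leading_monom f)"
proof -
  have "\<exists>t\<in>S. \<forall>s\<in>S. s \<noteq> t \<longrightarrow> deglex_less s t" if "finite S" "S \<noteq> {}" for S
    using that
  proof (induction S rule: finite_ne_induct)
    case (insert x S)
    then obtain t where t: "t \<in> S" "\<forall>s\<in>S. s \<noteq> t \<longrightarrow> deglex_less s t" by blast
    consider "deglex_less x t" | "deglex_less t x"
      using deglex_less_total[of x t] insert.hyps t by blast
    then show ?case
    proof cases
      case 2
      with t have "\<forall>s\<in>insert x S. s \<noteq> x \<longrightarrow> deglex_less s x"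
        using deglex_less_trans by (metis insert_iff)
      then show ?thesis by blast
    qed (use t in blast)
  qed simp
  from this[of "Poly_Mapping.keys f"] assms obtain t where "is_leading_monom f t"
    by (auto simp: is_leading_monom_def)
  then show ?thesis by (simp add: leading_monom_eqI)
qed

text \<open>No pair of monomials other than \<open>t\<close> and \<open>u\<close> has product
  \<open>t + u\<close>, because replacing one of them by a smaller monomial makes the product
  smaller. Hence nothing can cancel the product of the leading coefficients.\<close>

lemma lookup_mult_leading:
  fixes f g :: "'a::comm_ring_1 tpoly"
  assumes f: "is_leading_monom f t" and g: "is_leading_monom g u"
  shows "Poly_Mapping.lookup (f * g) (t + u) = Poly_Mapping.lookup f t * Poly_Mapping.lookup g u"
proof -
  have eq: "r + s = t + u \<longleftrightarrow> r = t \<and> s = u"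
    if "r \<in> Poly_Mapping.keys f" "s \<in> Poly_Mapping.keys g" for r s
  proof
    assume rs: "r + s = t + u"
    show "r = t \<and> s = u"
    proof (rule ccontr)
      assume "\<not> (r = t \<and> s = u)"
      with rs have "r \<noteq> t" "s \<noteq> u" by auto
      with f g that have "deglex_less r t" "deglex_less s u" by (auto simp: is_leading_monom_def)
      then have "deglex_less (r + s) (t + u)"
        using deglex_less_add[of r t s] deglex_less_add[of s u t] deglex_less_trans[of "r + s" "t + s" "t + u"]
        by (simp add: add.commute)
      with rs show False by (simp add: deglex_less_irrefl)
    qed
  qed auto
  have "f * g = (\<Sum>r\<in>Poly_Mapping.keys f. \<Sum>s\<in>Poly_Mapping.keys g.
      Poly_Mapping.single (r + s) (Poly_Mapping.lookup f r * Poly_Mapping.lookup g s))"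
    by (subst tpoly_expand[of f], subst tpoly_expand[of g]) (simp add: sum_product mult_single)
  then have "Poly_Mapping.lookup (f * g) (t + u) =
      (\<Sum>r\<in>Poly_Mapping.keys f. \<Sum>s\<in>Poly_Mapping.keys g.
        if r = t then if s = u then Poly_Mapping.lookup f r * Poly_Mapping.lookup g s else 0 else 0)"
    by (simp only: lookup_sum lookup_single when_def) (intro sum.cong refl, simp add: eq)
  also have "\<dots> = (\<Sum>r\<in>Poly_Mapping.keys f. if r = t then Poly_Mapping.lookup f r * Poly_Mapping.lookup g u else 0)"
    using g by (intro sum.cong refl) (auto simp: is_leading_monom_def)
  also have "\<dots> = Poly_Mapping.lookup f t * Poly_Mapping.lookup g u"
    using f by (auto simp: is_leading_monom_def)
  finally show ?thesis .
qed

lemma is_leading_monom_mult: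
  fixes f g :: "'a::idom tpoly"
  assumes f: "is_leading_monom f t" and g: "is_leading_monom g u"
  shows "is_leading_monom (f * g) (t + u)"
  unfolding is_leading_monom_def
proof (intro conjI ballI impI)
  show "t + u \<in> Poly_Mapping.keys (f * g)"
    using f g by (simp add: in_keys_iff lookup_mult_leading[OF f g] is_leading_monom_def)
next
  fix k assume k: "k \<in> Poly_Mapping.keys (f * g)" "k \<noteq> t + u"
  then obtain r s where rs: "k = r + s" "r \<in> Poly_Mapping.keys f" "s \<in> Poly_Mapping.keys g"
    using Poly_Mapping.keys_mult[of f g] by blast
  then consider "r \<noteq> t" "s = u" | "r = t" "s \<noteq> u" | "r \<noteq> t" "s \<noteq> u" using k(2) by blast
  then show "deglex_less k (t + u)"
  proof cases
    case 1
    with f rs show ?thesis by (auto simp: is_leading_monom_def intro: deglex_less_add)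
  next
    case 2
    with g rs have "deglex_less (s + t) (u + t)"
      by (auto simp: is_leading_monom_def intro: deglex_less_add)
    with 2 rs show ?thesis by (simp add: add.commute)
  next
    case 3
    with f g rs have "deglex_less (r + s) (t + s)" "deglex_less (s + t) (u + t)"
      by (auto simp: is_leading_monom_def intro: deglex_less_add)
    with rs show ?thesis using deglex_less_trans[of "r + s" "t + s" "t + u"]
      by (simp add: add.commute)
  qed
qed

lemma lm_mult:
  fixes f g :: "'a::idom tpoly"
  assumes "f \<noteq> 0" "g \<noteq> 0"
  shows "f * g \<noteq> 0" "lm (f * g) = lm f * lm g"
proof -
  have lead: "is_leading_monom (f * g) (leading_monom f + leading_monom g)"
    using assms by (intro is_leading_monom_mult is_leading_monom_leading_monom)
  then show "f * g \<noteq> 0" by (auto simp: is_leading_monom_def)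
  from lead show "lm (f * g) = lm f * lm g"
    by (simp add: lm_def leading_monom_eqI tmonomial_def mult_single)
qed

lemma lm_power:
  fixes f :: "'a::idom tpoly"
  assumes "f \<noteq> 0"
  shows "f ^ k \<noteq> 0" "lm (f ^ k) = lm f ^ k"
proof -
  have "is_leading_monom (1 :: 'a tpoly) 0" by (simp add: is_leading_monom_def)
  then have one: "lm (1 :: 'a tpoly) = 1" by (simp add: lm_def leading_monom_eqI tmonomial_def)
  have "f ^ k \<noteq> 0 \<and> lm (f ^ k) = lm f ^ k"
    using assms by (induction k) (auto simp: one lm_mult)
  then show "f ^ k \<noteq> 0" "lm (f ^ k) = lm f ^ k" by auto
qed

lemma lookup_tconst_mult: "Poly_Mapping.lookup (tconst c * f) t = c * Poly_Mapping.lookup f t"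
  for f :: "'a::comm_ring_1 tpoly"
proof -
  have "Poly_Mapping.map ((*) c) f = tconst c * f"
    unfolding tconst_def by (rule mult_map_scale_conv_mult)
  then have "Poly_Mapping.lookup (tconst c * f) t = Poly_Mapping.lookup (Poly_Mapping.map ((*) c) f) t"
    by simp
  then show ?thesis by (simp add: Poly_Mapping.map.rep_eq when_def)
qed

text \<open>Degrees are compared before exponents, so no monomial of \<open>g\<close> can interfere.
  This isolates the top power in a polynomial in \<open>D\<close>.\<close>

lemma lm_add_lower_degree:
  fixes f g :: "'a::comm_ring_1 tpoly"
  assumes f: "f \<noteq> 0"
    and deg: "\<And>s t. s \<in> Poly_Mapping.keys g \<Longrightarrow> t \<in> Poly_Mapping.keys f \<Longrightarrow> tmonom_degree s < tmonom_degree t"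
  shows "f + g \<noteq> 0" "lm (f + g) = lm f"
proof -
  let ?t = "leading_monom f"
  have t: "?t \<in> Poly_Mapping.keys f" "\<And>s. s \<in> Poly_Mapping.keys f \<Longrightarrow> s \<noteq> ?t \<Longrightarrow> deglex_less s ?t"
    using is_leading_monom_leading_monom[OF f] by (auto simp: is_leading_monom_def)
  have "?t \<notin> Poly_Mapping.keys g" using deg[of ?t ?t] t(1) by auto
  then have tk: "?t \<in> Poly_Mapping.keys (f + g)"
    using t(1) by (auto simp: in_keys_iff lookup_add)
  moreover have "deglex_less s ?t" if "s \<in> Poly_Mapping.keys (f + g)" "s \<noteq> ?t" for s
  proof -
    have "s \<in> Poly_Mapping.keys f \<or> s \<in> Poly_Mapping.keys g"
      using that(1) Poly_Mapping.keys_add[of f g] by blast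
    then show ?thesis
    proof
      assume "s \<in> Poly_Mapping.keys g"
      from deg[OF this t(1)] show ?thesis unfolding deglex_less_def by blast
    qed (use t(2) that(2) in blast)
  qed
  ultimately have "is_leading_monom (f + g) ?t" by (simp add: is_leading_monom_def)
  then show "lm (f + g) = lm f" by (simp add: lm_def leading_monom_eqI)
  from tk show "f + g \<noteq> 0" by auto
qed

subsection \<open>Algebras generated by one homogeneous polynomial\<close>

lemma is_subalgebra_generated_algebra: "is_subalgebra (generated_algebra S)"
  unfolding is_subalgebra_def generated_algebra_def hull_def by blast

lemma generated_algebra_superset: "S \<subseteq> generated_algebra S"
  unfolding generated_algebra_def by (rule hull_subset)

lemma generated_algebra_subset: "S \<subseteq> A \<Longrightarrow> is_subalgebra A \<Longrightarrow> generated_algebra S \<subseteq> A"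
  unfolding generated_algebra_def by (rule hull_minimal)

lemma is_subalgebra_power:
  assumes A: "is_subalgebra A" and "f \<in> A"
  shows "f ^ k \<in> A"
proof (induction k)
  case 0
  have "tconst 1 \<in> A" using A by (auto simp: is_subalgebra_def)
  then show ?case by (simp add: tconst_def)
qed (use assms in \<open>auto simp: is_subalgebra_def\<close>)

lemma is_subalgebra_sum:
  assumes A: "is_subalgebra A" and "\<And>i. i \<in> I \<Longrightarrow> f i \<in> A"
  shows "(\<Sum>i\<in>I. f i) \<in> A"
proof -
  have "tconst 0 \<in> A" using A by (auto simp: is_subalgebra_def)
  then have "0 \<in> A" by (simp add: tconst_def)
  with assms(2) show ?thesis
    by (induction I rule: infinite_finite_induct) (use A in \<open>auto simp: is_subalgebra_def\<close>)
qed

lemma homogeneous_power_keys: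
  fixes f :: "'a::comm_ring_1 tpoly"
  assumes "\<And>t. t \<in> Poly_Mapping.keys f \<Longrightarrow> tmonom_degree t = N"
  shows "t \<in> Poly_Mapping.keys (f ^ k) \<Longrightarrow> tmonom_degree t = k * N"
proof (induction k arbitrary: t)
  case 0
  then show ?case by (simp add: tmonom_degree_def)
next
  case (Suc k)
  then obtain r s where "t = r + s" "r \<in> Poly_Mapping.keys f" "s \<in> Poly_Mapping.keys (f ^ k)"
    using Poly_Mapping.keys_mult[of f "f ^ k"] by auto
  with Suc.IH[of s] assms[of r] show ?case by (simp add: tmonom_degree_add)
qed

text \<open>The powers of \<open>D\<close> are homogeneous of the distinct degrees
  \<open>i * N\<close>, so the highest power with nonzero coefficient outranks the others by degree
  alone. Its exponent is the \<open>k\<close> found, which lies below \<open>K\<close> if the top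
  coefficient vanishes.\<close>

lemma lm_polynomial_in_homogeneous:
  fixes D :: "'a::idom tpoly"
  assumes D: "D \<noteq> 0" and hom: "\<And>t. t \<in> Poly_Mapping.keys D \<Longrightarrow> tmonom_degree t = N" and N: "0 < N"
  shows "(\<Sum>i\<le>K. tconst (c i) * D ^ i) \<noteq> 0 \<Longrightarrow>
    \<exists>k. lm (\<Sum>i\<le>K. tconst (c i) * D ^ i) = lm D ^ k"
proof (induction K)
  case 0
  then have "is_leading_monom (tconst (c 0)) 0"
    by (auto simp: is_leading_monom_def tconst_def split: if_splits)
  then have "lm (tconst (c 0)) = lm D ^ 0"
    by (simp add: lm_def leading_monom_eqI tmonomial_def)
  then show ?case by (intro exI[of _ 0]) simp
next
  case (Suc K)
  let ?s = "\<Sum>i\<le>K. tconst (c i) * D ^ i"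
  show ?case
  proof (cases "c (Suc K) = 0")
    case True
    then have "tconst (c (Suc K)) = 0" by (simp add: tconst_def)
    with Suc show ?thesis by simp
  next
    case False
    let ?c = "c (Suc K)" and ?f = "tconst (c (Suc K)) * D ^ Suc K"
    have keys: "Poly_Mapping.keys ?f = Poly_Mapping.keys (D ^ Suc K)"
      using False by (auto simp: in_keys_iff lookup_tconst_mult simp del: power_Suc)
    \<comment> \<open>The leading monomial depends on a polynomial only through its set of
      monomials, which a nonzero constant factor leaves alone.\<close>
    have "lm ?f = lm (D ^ Suc K)"
      unfolding lm_def leading_monom_def keys ..
    also have "\<dots> = lm D ^ Suc K" by (rule lm_power(2)[OF D])
    finally have lmf: "lm ?f = lm D ^ Suc K" .
    have f0: "?f \<noteq> 0"
      using keys lm_power(1)[OF D, of "Suc K"] by (metis keys_eq_empty)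
    have "tmonom_degree s < tmonom_degree t"
      if s: "s \<in> Poly_Mapping.keys ?s" and t: "t \<in> Poly_Mapping.keys ?f" for s t
    proof -
      from s have "(\<Sum>i\<le>K. c i * Poly_Mapping.lookup (D ^ i) s) \<noteq> 0"
        by (simp add: in_keys_iff lookup_sum lookup_tconst_mult)
      then obtain i where "i \<le> K" "Poly_Mapping.lookup (D ^ i) s \<noteq> 0"
        by (metis (no_types, lifting) atMost_iff mult_zero_right sum.neutral)
      then have "tmonom_degree s = i * N"
        using homogeneous_power_keys[of D N, OF hom] by (auto simp: in_keys_iff)
      also have "\<dots> < Suc K * N" using \<open>i \<le> K\<close> N by (intro mult_less_mono1) auto
      also have "\<dots> = tmonom_degree t"
        using t homogeneous_power_keys[of D N t "Suc K", OF hom] unfolding keys by simp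
      finally show ?thesis .
    qed
    then have "lm (?f + ?s) = lm ?f" by (rule lm_add_lower_degree(2)[OF f0])
    with lmf have "lm (\<Sum>i\<le>Suc K. tconst (c i) * D ^ i) = lm D ^ Suc K"
      by (simp add: add.commute)
    then show ?thesis by blast
  qed
qed

lemma sagbi_basis_homogeneous_generator:
  fixes D :: "'a::idom tpoly"
  assumes A: "is_subalgebra A" and DA: "D \<in> A" and D: "D \<noteq> 0"
    and hom: "\<And>t. t \<in> Poly_Mapping.keys D \<Longrightarrow> tmonom_degree t = N" and N: "0 < N"
    and gen: "\<And>f. f \<in> A \<Longrightarrow> \<exists>c K. f = (\<Sum>i\<le>K. tconst (c i) * D ^ i)"
  shows "is_sagbi_basis {D} A" "A = generated_algebra {D}"
proof -
  have "A \<subseteq> generated_algebra {D}"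
  proof
    fix f assume "f \<in> A"
    then obtain c K where f: "f = (\<Sum>i\<le>K. tconst (c i) * D ^ i)" using gen by blast
    have sub: "is_subalgebra (generated_algebra {D})" by (rule is_subalgebra_generated_algebra)
    have "D \<in> generated_algebra {D}" using generated_algebra_superset by blast
    then have "tconst (c i) * D ^ i \<in> generated_algebra {D}" for i
      using sub is_subalgebra_power[OF sub, of D i] unfolding is_subalgebra_def by blast
    then show "f \<in> generated_algebra {D}" unfolding f by (intro is_subalgebra_sum[OF sub])
  qed
  then show "A = generated_algebra {D}"
    using generated_algebra_subset[of "{D}" A] A DA by blast
  have sub: "is_subalgebra (generated_algebra {lm D})" by (rule is_subalgebra_generated_algebra)
  have "lm f \<in> generated_algebra {lm D}" if "f \<in> A" "f \<noteq> 0" for f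
  proof -
    from gen that(1) obtain c K where "f = (\<Sum>i\<le>K. tconst (c i) * D ^ i)" by blast
    with that(2) obtain k where "lm f = lm D ^ k"
      using lm_polynomial_in_homogeneous[OF D hom N, of c K] by blast
    moreover have "lm D \<in> generated_algebra {lm D}" using generated_algebra_superset by blast
    ultimately show ?thesis using is_subalgebra_power[OF sub] by simp
  qed
  then have "generated_algebra (lm ` {f \<in> A. f \<noteq> 0}) \<subseteq> generated_algebra {lm D}"
    by (intro generated_algebra_subset sub) auto
  moreover have "generated_algebra {lm D} \<subseteq> generated_algebra (lm ` {f \<in> A. f \<noteq> 0})"
    using generated_algebra_superset[of "lm ` {f \<in> A. f \<noteq> 0}"] DA D
    by (intro generated_algebra_subset is_subalgebra_generated_algebra) auto
  ultimately show "is_sagbi_basis {D} A"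
    using A DA D by (auto simp: is_sagbi_basis_def)
qed

subsection \<open>The generic pencil\<close>

definition hcat :: "'a mat \<Rightarrow> 'a mat \<Rightarrow> 'a mat" where
  "hcat A B = mat (dim_row A) (dim_col A + dim_col B)
     (\<lambda>(i, j). if j < dim_col A then A $$ (i, j) else B $$ (i, j - dim_col A))"

lemma hcat_carrier [intro]:
  "A \<in> carrier_mat r a \<Longrightarrow> B \<in> carrier_mat r b \<Longrightarrow> hcat A B \<in> carrier_mat r (a + b)"
  by (auto simp: hcat_def)

text \<open>Lower blocks without rows turn a concatenation into a four-block matrix, so that its
  products follow from the rule for four blocks.\<close>

lemma hcat_eq_four_block_mat:
  assumes "A \<in> carrier_mat r a" "B \<in> carrier_mat r b" "C \<in> carrier_mat 0 a" "D \<in> carrier_mat 0 b"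
  shows "four_block_mat A B C D = hcat A B"
  using assms by (intro eq_matI) (auto simp: hcat_def)

lemma hcat_mult_four_block_mat:
  assumes A: "A \<in> carrier_mat r a" and B: "B \<in> carrier_mat r b"
    and "C \<in> carrier_mat a c" "D \<in> carrier_mat a d" "E \<in> carrier_mat b c" "F \<in> carrier_mat b d"
  shows "hcat A B * four_block_mat C D E F = hcat (A * C + B * E) (A * D + B * F)"
proof -
  let ?Z = "\<lambda>k. 0\<^sub>m 0 k"
  have "hcat A B = four_block_mat A B (?Z a) (?Z b)"
    by (rule hcat_eq_four_block_mat[symmetric, OF A B]) auto
  also have "\<dots> * four_block_mat C D E F = four_block_mat (A * C + B * E) (A * D + B * F)
      (?Z a * C + ?Z b * E) (?Z a * D + ?Z b * F)"
    by (rule mult_four_block_mat) (use assms in auto)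
  also have "\<dots> = hcat (A * C + B * E) (A * D + B * F)"
    by (rule hcat_eq_four_block_mat) (use assms in auto)
  finally show ?thesis .
qed

lemma mult_hcat:
  assumes "P \<in> carrier_mat q r" "A \<in> carrier_mat r a" "B \<in> carrier_mat r b"
  shows "P * hcat A B = hcat (P * A) (P * B)"
  by (rule eq_matI) (use assms in \<open>auto simp: hcat_def scalar_prod_def\<close>)

lemma hcat_add:
  assumes "A \<in> carrier_mat r a" "B \<in> carrier_mat r b" "C \<in> carrier_mat r a" "D \<in> carrier_mat r b"
  shows "hcat A B + hcat C D = hcat (A + C) (B + D)"
  by (rule eq_matI) (use assms in \<open>auto simp: hcat_def\<close>)

lemma hcat_smult:
  assumes "A \<in> carrier_mat r a" "B \<in> carrier_mat r b"
  shows "t \<cdot>\<^sub>m hcat A B = hcat (t \<cdot>\<^sub>m A) (t \<cdot>\<^sub>m B)"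
  by (rule eq_matI) (use assms in \<open>auto simp: hcat_def\<close>)

lemma carrier_mat_hcatE:
  assumes "X \<in> carrier_mat r (a + b)"
  obtains A B where "A \<in> carrier_mat r a" "B \<in> carrier_mat r b" "X = hcat A B"
proof
  let ?A = "mat r a (\<lambda>(i, j). X $$ (i, j))" and ?B = "mat r b (\<lambda>(i, j). X $$ (i, j + a))"
  show "?A \<in> carrier_mat r a" "?B \<in> carrier_mat r b" by auto
  show "X = hcat ?A ?B" by (rule eq_matI) (use assms in \<open>auto simp: hcat_def\<close>)
qed

lemma carrier_mat_four_block_matE:
  assumes "X \<in> carrier_mat (r + s) (a + b)"
  obtains A B C D where "A \<in> carrier_mat r a" "B \<in> carrier_mat r b"
    "C \<in> carrier_mat s a" "D \<in> carrier_mat s b" "X = four_block_mat A B C D"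
proof -
  obtain A B C D where "split_block X r a = (A, B, C, D)" by (metis prod_cases4)
  from split_block[OF this, of s b] assms show ?thesis using that by auto
qed

lemma mat_inverse_exists:
  fixes A :: "'a::field mat"
  assumes A: "A \<in> carrier_mat n n" and "det A \<noteq> 0"
  obtains B where "B \<in> carrier_mat n n" "A * B = 1\<^sub>m n" "B * A = 1\<^sub>m n" "det B \<noteq> 0"
proof -
  from det_non_zero_imp_unit[OF assms, of "()"] obtain B where B: "B \<in> carrier_mat n n"
    "A * B = 1\<^sub>m n" "B * A = 1\<^sub>m n"
    unfolding Units_def by (auto simp: ring_mat_def)
  have "det A * det B = 1" using det_mult[OF A B(1)] B(2) by simp
  then have "det B \<noteq> 0" by auto
  with B that show ?thesis by blast
qed

text \<open>The determinant vanishes only when \<open>- t\<close> is a root of the characteristic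
  polynomial of \<open>A\<close>, which is monic and has finitely many roots. Every normalization
  below moves a block along the identity to make it invertible.\<close>

lemma infinite_det_add_smult_one:
  fixes A :: "'a::field mat"
  assumes inf: "infinite (UNIV :: 'a set)" and A: "A \<in> carrier_mat n n"
  shows "infinite {t. det (A + t \<cdot>\<^sub>m 1\<^sub>m n) \<noteq> 0}"
proof
  assume fin: "finite {t. det (A + t \<cdot>\<^sub>m 1\<^sub>m n) \<noteq> 0}"
  have "char_poly A \<noteq> 0" using degree_monic_char_poly[OF A] by auto
  then have "finite {x. poly (char_poly A) x = 0}" by (rule poly_roots_finite)
  then have "finite (uminus ` {x. poly (char_poly A) x = 0})" by (rule finite_imageI)
  moreover have "{t. det (A + t \<cdot>\<^sub>m 1\<^sub>m n) = 0} \<subseteq> uminus ` {x. poly (char_poly A) x = 0}"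
  proof
    fix t assume "t \<in> {t. det (A + t \<cdot>\<^sub>m 1\<^sub>m n) = 0}"
    then have "det (char_matrix A (- t)) = 0" using A by (simp add: char_matrix_def)
    then have "poly (char_poly A) (- t) = 0"
      using eigenvalue_det[OF A] eigenvalue_root_char_poly[OF A] by blast
    then show "t \<in> uminus ` {x. poly (char_poly A) x = 0}"
      by (intro image_eqI[of _ _ "- t"]) auto
  qed
  ultimately have "finite {t. det (A + t \<cdot>\<^sub>m 1\<^sub>m n) = 0}" by (rule finite_subset[rotated])
  with fin have "finite ({t. det (A + t \<cdot>\<^sub>m 1\<^sub>m n) \<noteq> 0} \<union> {t. det (A + t \<cdot>\<^sub>m 1\<^sub>m n) = 0})" by simp
  moreover have "{t. det (A + t \<cdot>\<^sub>m 1\<^sub>m n) \<noteq> 0} \<union> {t. det (A + t \<cdot>\<^sub>m 1\<^sub>m n) = 0} = UNIV" by auto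
  ultimately show False using inf by simp
qed

section \<open>Closed sets of pencils, and the shift pencil as a normal form\<close>

text \<open>Sets of pencils that behave like the zero set of a semi-invariant; closedness in the Zariski
  topology is only needed along lines.\<close>

definition stable_closed :: "nat \<Rightarrow> nat \<Rightarrow> ('a::field mat \<Rightarrow> 'a mat \<Rightarrow> bool) \<Rightarrow> bool" where
  "stable_closed m n Z \<longleftrightarrow>
     (\<forall>X \<in> carrier_mat m n. \<forall>Y \<in> carrier_mat m n.
        (\<forall>P \<in> carrier_mat m m. \<forall>Q \<in> carrier_mat n n. det P \<noteq> 0 \<longrightarrow> det Q \<noteq> 0 \<longrightarrow>
           Z (P * X * Q) (P * Y * Q) \<longrightarrow> Z X Y) \<and>
        (\<forall>X' \<in> carrier_mat m n. \<forall>Y' \<in> carrier_mat m n.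
           infinite {t. Z (X + t \<cdot>\<^sub>m X') (Y + t \<cdot>\<^sub>m Y')} \<longrightarrow> Z X Y))"

lemma stable_closedI:
  assumes "\<And>X Y P Q. X \<in> carrier_mat m n \<Longrightarrow> Y \<in> carrier_mat m n \<Longrightarrow>
      P \<in> carrier_mat m m \<Longrightarrow> Q \<in> carrier_mat n n \<Longrightarrow> det P \<noteq> 0 \<Longrightarrow> det Q \<noteq> 0 \<Longrightarrow>
      Z (P * X * Q) (P * Y * Q) \<Longrightarrow> Z X Y"
    and "\<And>X Y X' Y'. X \<in> carrier_mat m n \<Longrightarrow> Y \<in> carrier_mat m n \<Longrightarrow>
      X' \<in> carrier_mat m n \<Longrightarrow> Y' \<in> carrier_mat m n \<Longrightarrow>
      infinite {t. Z (X + t \<cdot>\<^sub>m X') (Y + t \<cdot>\<^sub>m Y')} \<Longrightarrow> Z X Y"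
  shows "stable_closed m n Z"
  unfolding stable_closed_def using assms by blast

lemma stable_closed_equiv:
  assumes "stable_closed m n Z" "X \<in> carrier_mat m n" "Y \<in> carrier_mat m n"
    and "P \<in> carrier_mat m m" "det P \<noteq> 0" "Q \<in> carrier_mat n n" "det Q \<noteq> 0"
    and "P * X * Q = X'" "P * Y * Q = Y'" "Z X' Y'"
  shows "Z X Y"
  using assms unfolding stable_closed_def by blast

text \<open>In the normalization steps, \<open>T\<close> consists of the parameters that make a
  certain block invertible; the pencil at \<open>t = 0\<close>, where the block may be singular,
  inherits \<open>Z\<close> from them.\<close>

lemma stable_closed_line:
  assumes "stable_closed m n Z" "X \<in> carrier_mat m n" "Y \<in> carrier_mat m n"
    and "X' \<in> carrier_mat m n" "Y' \<in> carrier_mat m n"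
    and "infinite T" "\<And>t. t \<in> T \<Longrightarrow> Z (X + t \<cdot>\<^sub>m X') (Y + t \<cdot>\<^sub>m Y')"
  shows "Z X Y"
proof -
  have "T \<subseteq> {t. Z (X + t \<cdot>\<^sub>m X') (Y + t \<cdot>\<^sub>m Y')}" using assms(7) by blast
  with assms(6) have "infinite {t. Z (X + t \<cdot>\<^sub>m X') (Y + t \<cdot>\<^sub>m Y')}"
    using finite_subset by blast
  with assms(1-5) show ?thesis unfolding stable_closed_def by blast
qed

text \<open>The pencil \<open>shift_X m e, shift_Y m e\<close> is a direct sum of \<open>e\<close> Kronecker blocks, one for each
  residue class modulo \<open>e\<close>, of sizes that differ by at most 1.\<close>

definition shift_X :: "nat \<Rightarrow> nat \<Rightarrow> 'a::zero_neq_one mat" where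
  "shift_X m e = mat m (m + e) (\<lambda>(i, j). if j = i then 1 else 0)"

definition shift_Y :: "nat \<Rightarrow> nat \<Rightarrow> 'a::zero_neq_one mat" where
  "shift_Y m e = mat m (m + e) (\<lambda>(i, j). if j = i + e then 1 else 0)"

lemma shift_carrier [simp]:
  "shift_X m e \<in> carrier_mat m (m + e)" "shift_Y m e \<in> carrier_mat m (m + e)"
  by (auto simp: shift_X_def shift_Y_def)

lemma dim_shift [simp]:
  "dim_row (shift_X m e) = m" "dim_col (shift_X m e) = m + e"
  "dim_row (shift_Y m e) = m" "dim_col (shift_Y m e) = m + e"
  by (auto simp: shift_X_def shift_Y_def)

lemma shift_X_eq_hcat: "shift_X m e = hcat (1\<^sub>m m) (0\<^sub>m m e)"
  by (rule eq_matI) (auto simp: shift_X_def hcat_def)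

text \<open>Once the left block of \<open>X\<close> is invertible, column operations turn
  \<open>X\<close> into (I | 0). They change \<open>Y\<close> as well, which is harmless because
  \<open>norm\<close> admits every second matrix.\<close>

lemma stable_closed_all_if_shift_X:
  fixes Z :: "'a::field mat \<Rightarrow> 'a mat \<Rightarrow> bool"
  assumes inf: "infinite (UNIV :: 'a set)" and Z: "stable_closed m (m + e) Z"
    and norm: "\<And>Y. Y \<in> carrier_mat m (m + e) \<Longrightarrow> Z (shift_X m e) Y"
    and X: "X \<in> carrier_mat m (m + e)" and Y: "Y \<in> carrier_mat m (m + e)"
  shows "Z X Y"
proof -
  obtain X1 X2 where X12: "X1 \<in> carrier_mat m m" "X2 \<in> carrier_mat m e" "X = hcat X1 X2"
    using X by (rule carrier_mat_hcatE)
  show ?thesis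
  proof (rule stable_closed_line[OF Z X Y shift_carrier(1) zero_carrier_mat
        infinite_det_add_smult_one[OF inf X12(1)]])
    fix t assume "t \<in> {t. det (X1 + t \<cdot>\<^sub>m 1\<^sub>m m) \<noteq> 0}"
    moreover define U where "U = X1 + t \<cdot>\<^sub>m 1\<^sub>m m"
    moreover have U: "U \<in> carrier_mat m m" using X12 by (simp add: U_def)
    ultimately obtain S where S: "S \<in> carrier_mat m m" "U * S = 1\<^sub>m m" "det S \<noteq> 0"
      using mat_inverse_exists[OF U] by auto
    have XU: "X + t \<cdot>\<^sub>m shift_X m e = hcat U X2"
    proof -
      have "t \<cdot>\<^sub>m shift_X m e = hcat (t \<cdot>\<^sub>m 1\<^sub>m m) (0\<^sub>m m e)"
        unfolding shift_X_eq_hcat by (subst hcat_smult[of _ m m _ e]) auto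
      then show ?thesis using X12 by (simp add: hcat_add[of _ m m _ e] U_def)
    qed
    \<comment> \<open>\<open>S\<close> inverts the left block \<open>U\<close>, and the upper right
      block of \<open>?Q\<close> clears \<open>X2\<close>, since
      \<open>U * S * X2 = X2\<close>.\<close>
    let ?Q = "four_block_mat S (- (S * X2)) (0\<^sub>m e m) (1\<^sub>m e)"
    show "Z (X + t \<cdot>\<^sub>m shift_X m e) (Y + t \<cdot>\<^sub>m 0\<^sub>m m (m + e))"
    proof (rule stable_closed_equiv[OF Z, where P = "1\<^sub>m m" and Q = ?Q and X' = "shift_X m e"])
      show "det ?Q \<noteq> 0"
        using S X12 by (subst det_four_block_mat_lower_left_zero[of _ m _ e]) auto
      have "hcat U X2 * ?Q = hcat (U * S + X2 * 0\<^sub>m e m) (U * (- (S * X2)) + X2 * 1\<^sub>m e)"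
        using S X12 U by (intro hcat_mult_four_block_mat) auto
      also have "U * (- (S * X2)) = - (U * S * X2)"
        using S(1) X12 U by (simp add: assoc_mult_mat[of _ m m _ m _ e])
      also have "- (U * S * X2) + X2 * 1\<^sub>m e = 0\<^sub>m m e"
        using S X12 by simp
      finally have "hcat U X2 * ?Q = shift_X m e"
        using S X12 by (simp add: shift_X_eq_hcat)
      then show "1\<^sub>m m * (X + t \<cdot>\<^sub>m shift_X m e) * ?Q = shift_X m e"
        using U X12 unfolding XU by (metis hcat_carrier left_mult_one_mat)
      show "Z (shift_X m e) (1\<^sub>m m * (Y + t \<cdot>\<^sub>m 0\<^sub>m m (m + e)) * ?Q)"
        by (rule norm) (use S Y in auto)
    qed (use X Y S in auto)
  qed
qed

text \<open>For \<open>m \<le> e\<close> the last \<open>m\<close> columns of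
  \<open>shift_X m e\<close> vanish. Column operations that recombine these columns and add
  multiples of them to the others fix \<open>shift_X\<close> and bring \<open>Y\<close> to (0 | I),
  provided its last block is invertible.\<close>

lemma stable_closed_all_base:
  fixes Z :: "'a::field mat \<Rightarrow> 'a mat \<Rightarrow> bool"
  assumes inf: "infinite (UNIV :: 'a set)" and Z: "stable_closed m (m + e) Z"
    and shift: "Z (shift_X m e) (shift_Y m e)" and me: "m \<le> e"
    and Y: "Y \<in> carrier_mat m (m + e)"
  shows "Z (shift_X m e) Y"
proof -
  \<comment> \<open>The columns are now cut after \<open>e\<close>, not after \<open>m\<close>, so
    that the right block of \<open>Y\<close> is square of size \<open>m\<close>.\<close>
  have em: "m + e = e + m" by simp
  define V where "V = mat m e (\<lambda>(i, j). if j = i then (1::'a) else 0)"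
  have V: "V \<in> carrier_mat m e" by (simp add: V_def)
  have X0: "shift_X m e = hcat V (0\<^sub>m m m)"
    by (rule eq_matI) (use me in \<open>auto simp: shift_X_def hcat_def V_def\<close>)
  have Y0: "shift_Y m e = hcat (0\<^sub>m m e) (1\<^sub>m m)"
    by (rule eq_matI) (auto simp: shift_Y_def hcat_def)
  obtain A B where AB: "A \<in> carrier_mat m e" "B \<in> carrier_mat m m" "Y = hcat A B"
    using Y unfolding em by (rule carrier_mat_hcatE)
  show ?thesis
  proof (rule stable_closed_line[OF Z shift_carrier(1) Y zero_carrier_mat shift_carrier(2)
        infinite_det_add_smult_one[OF inf AB(2)]])
    fix t assume "t \<in> {t. det (B + t \<cdot>\<^sub>m 1\<^sub>m m) \<noteq> 0}"
    moreover define U where "U = B + t \<cdot>\<^sub>m 1\<^sub>m m"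
    moreover have U: "U \<in> carrier_mat m m" using AB by (simp add: U_def)
    ultimately obtain S where S: "S \<in> carrier_mat m m" "U * S = 1\<^sub>m m" "det S \<noteq> 0"
      using mat_inverse_exists[OF U] by auto
    have YU: "Y + t \<cdot>\<^sub>m shift_Y m e = hcat A U"
    proof -
      have "t \<cdot>\<^sub>m shift_Y m e = hcat (0\<^sub>m m e) (t \<cdot>\<^sub>m 1\<^sub>m m)"
        unfolding Y0 by (subst hcat_smult[of _ m e _ m]) auto
      then show ?thesis using AB by (simp add: hcat_add[of _ m e _ m] U_def)
    qed
    let ?Q = "four_block_mat (1\<^sub>m e) (0\<^sub>m e m) (- (S * A)) S"
    have XQ: "shift_X m e * ?Q = shift_X m e"
    proof -
      have "shift_X m e * ?Q = hcat (V * 1\<^sub>m e + 0\<^sub>m m m * (- (S * A))) (V * 0\<^sub>m e m + 0\<^sub>m m m * S)"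
        unfolding X0 using S AB V by (intro hcat_mult_four_block_mat) auto
      also have "0\<^sub>m m m * (- (S * A)) = 0\<^sub>m m e" using S AB by (intro left_mult_zero_mat) auto
      also have "hcat (V * 1\<^sub>m e + 0\<^sub>m m e) (V * 0\<^sub>m e m + 0\<^sub>m m m * S) = hcat V (0\<^sub>m m m)"
        using S AB V by simp
      finally show ?thesis by (simp add: X0)
    qed
    have YQ: "hcat A U * ?Q = shift_Y m e"
    proof -
      have "hcat A U * ?Q = hcat (A * 1\<^sub>m e + U * (- (S * A))) (A * 0\<^sub>m e m + U * S)"
        using S AB U by (intro hcat_mult_four_block_mat) auto
      also have "U * (- (S * A)) = - (U * S * A)"
        using S(1) AB U by (simp add: assoc_mult_mat[of _ m m _ m _ e])
      also have "hcat (A * 1\<^sub>m e + - (U * S * A)) (A * 0\<^sub>m e m + U * S) = shift_Y m e"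
        using S AB by (simp add: Y0 add_uminus_minus_mat[of _ m e])
      finally show ?thesis .
    qed
    show "Z (shift_X m e + t \<cdot>\<^sub>m 0\<^sub>m m (m + e)) (Y + t \<cdot>\<^sub>m shift_Y m e)"
    proof (rule stable_closed_equiv[OF Z, where P = "1\<^sub>m m" and Q = ?Q, OF _ _ _ _ _ _ _ _ shift])
      show "det ?Q \<noteq> 0"
        using S AB by (subst det_four_block_mat_upper_right_zero[of _ e _ m]) auto
      have "shift_X m e + t \<cdot>\<^sub>m 0\<^sub>m m (m + e) = (shift_X m e :: 'a mat)"
        using right_add_zero_mat[OF shift_carrier(1)] by simp
      then show "1\<^sub>m m * (shift_X m e + t \<cdot>\<^sub>m 0\<^sub>m m (m + e)) * ?Q = shift_X m e"
        using XQ by (metis left_mult_one_mat shift_carrier(1))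
      show "1\<^sub>m m * (Y + t \<cdot>\<^sub>m shift_Y m e) * ?Q = shift_Y m e"
        unfolding YU using YQ AB U by (metis hcat_carrier left_mult_one_mat)
    qed (use Y S AB em in auto)
  qed
qed


text \<open>A pair \<open>(P, Q)\<close> acts on the extended pencil through diag(P, I) and diag(Q,
  I), which replaces \<open>R\<close> by \<open>R * Q\<close>. Quantifying over all \<open>R\<close>
  makes the predicate on small pencils insensitive to this.\<close>

lemma stable_closed_extend:
  fixes Z :: "'a::field mat \<Rightarrow> 'a mat \<Rightarrow> bool"
  assumes Z: "stable_closed (a + e) (a + e + e) Z"
  shows "stable_closed a (a + e) (\<lambda>X Y. \<forall>R \<in> carrier_mat e (a + e).
    Z (four_block_mat X (0\<^sub>m a e) R (0\<^sub>m e e)) (four_block_mat Y (0\<^sub>m a e) (0\<^sub>m e (a + e)) (1\<^sub>m e)))"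
proof (rule stable_closedI)
  let ?M = "a + e"
  let ?FX = "\<lambda>X R. four_block_mat X (0\<^sub>m a e) R (0\<^sub>m e e)"
  let ?FY = "\<lambda>Y. four_block_mat Y (0\<^sub>m a e) (0\<^sub>m e ?M) (1\<^sub>m e)"
  fix X Y P Q :: "'a mat"
  assume X: "X \<in> carrier_mat a ?M" and Y: "Y \<in> carrier_mat a ?M"
    and P: "P \<in> carrier_mat a a" "det P \<noteq> 0" and Q: "Q \<in> carrier_mat ?M ?M" "det Q \<noteq> 0"
    and ZPQ: "\<forall>R \<in> carrier_mat e ?M. Z (?FX (P * X * Q) R) (?FY (P * Y * Q))"
  show "\<forall>R \<in> carrier_mat e ?M. Z (?FX X R) (?FY Y)"
  proof
    fix R :: "'a mat" assume R: "R \<in> carrier_mat e ?M"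
    let ?P = "four_block_mat P (0\<^sub>m a e) (0\<^sub>m e a) (1\<^sub>m e)"
    let ?Q = "four_block_mat Q (0\<^sub>m ?M e) (0\<^sub>m e ?M) (1\<^sub>m e)"
    have mult: "?P * four_block_mat W (0\<^sub>m a e) C D * ?Q =
        four_block_mat (P * W * Q) (0\<^sub>m a e) (C * Q) D"
      if "W \<in> carrier_mat a ?M" "C \<in> carrier_mat e ?M" "D \<in> carrier_mat e e" for W C D
    proof -
      have "?P * four_block_mat W (0\<^sub>m a e) C D = four_block_mat (P * W + 0\<^sub>m a e * C)
          (P * 0\<^sub>m a e + 0\<^sub>m a e * D) (0\<^sub>m e a * W + 1\<^sub>m e * C) (0\<^sub>m e a * 0\<^sub>m a e + 1\<^sub>m e * D)"
        by (rule mult_four_block_mat[of _ a a _ e _ e _ _ ?M _ e]) (use that P in auto)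
      also have "\<dots> = four_block_mat (P * W) (0\<^sub>m a e) C D"
        using that P by simp
      also have "\<dots> * ?Q = four_block_mat (P * W * Q + 0\<^sub>m a e * 0\<^sub>m e ?M)
          (P * W * 0\<^sub>m ?M e + 0\<^sub>m a e * 1\<^sub>m e) (C * Q + D * 0\<^sub>m e ?M) (C * 0\<^sub>m ?M e + D * 1\<^sub>m e)"
        by (rule mult_four_block_mat[of _ a ?M _ e _ e _ _ ?M _ e]) (use that P Q in auto)
      also have "\<dots> = four_block_mat (P * W * Q) (0\<^sub>m a e) (C * Q) D"
        using that P Q by simp
      finally show ?thesis .
    qed
    show "Z (?FX X R) (?FY Y)"
    proof (rule stable_closed_equiv[OF Z, where P = ?P and Q = ?Q])
      show "?P * ?FX X R * ?Q = ?FX (P * X * Q) (R * Q)"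
        by (rule mult) (use X R in auto)
      have "?P * ?FY Y * ?Q = four_block_mat (P * Y * Q) (0\<^sub>m a e) (0\<^sub>m e ?M * Q) (1\<^sub>m e)"
        by (rule mult) (use Y in auto)
      then show "?P * ?FY Y * ?Q = ?FY (P * Y * Q)" using Q by simp
      show "Z (?FX (P * X * Q) (R * Q)) (?FY (P * Y * Q))"
        using ZPQ R Q by auto
      show "det ?P \<noteq> 0"
        using P by (subst det_four_block_mat_upper_right_zero[of _ a _ e]) auto
      show "det ?Q \<noteq> 0"
        using Q by (subst det_four_block_mat_upper_right_zero[of _ ?M _ e]) auto
    qed (use X Y R P Q in auto)
  qed
next
  let ?M = "a + e"
  let ?FX = "\<lambda>X R. four_block_mat X (0\<^sub>m a e) R (0\<^sub>m e e)"
  let ?FY = "\<lambda>Y. four_block_mat Y (0\<^sub>m a e) (0\<^sub>m e ?M) (1\<^sub>m e)"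
  let ?D = "\<lambda>W. four_block_mat W (0\<^sub>m a e) (0\<^sub>m e ?M) (0\<^sub>m e e)"
  fix X Y X' Y' :: "'a mat"
  assume X: "X \<in> carrier_mat a ?M" and Y: "Y \<in> carrier_mat a ?M"
    and X': "X' \<in> carrier_mat a ?M" and Y': "Y' \<in> carrier_mat a ?M"
    and inf: "infinite {t. \<forall>R \<in> carrier_mat e ?M.
      Z (?FX (X + t \<cdot>\<^sub>m X') R) (?FY (Y + t \<cdot>\<^sub>m Y'))}"
  show "\<forall>R \<in> carrier_mat e ?M. Z (?FX X R) (?FY Y)"
  proof
    fix R :: "'a mat" assume R: "R \<in> carrier_mat e ?M"
    have add: "four_block_mat W (0\<^sub>m a e) C D + t \<cdot>\<^sub>m ?D W' = four_block_mat (W + t \<cdot>\<^sub>m W') (0\<^sub>m a e) C D"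
      if "W \<in> carrier_mat a ?M" "W' \<in> carrier_mat a ?M" "C \<in> carrier_mat e ?M" "D \<in> carrier_mat e e"
      for W W' C D :: "'a mat" and t
      by (rule eq_matI) (use that in auto)
    show "Z (?FX X R) (?FY Y)"
    proof (rule stable_closed_line[OF Z _ _ _ _ inf, where X' = "?D X'" and Y' = "?D Y'"])
      fix t assume "t \<in> {t. \<forall>R \<in> carrier_mat e ?M. Z (?FX (X + t \<cdot>\<^sub>m X') R) (?FY (Y + t \<cdot>\<^sub>m Y'))}"
      then have "Z (?FX (X + t \<cdot>\<^sub>m X') R) (?FY (Y + t \<cdot>\<^sub>m Y'))" using R by blast
      then show "Z (?FX X R + t \<cdot>\<^sub>m ?D X') (?FY Y + t \<cdot>\<^sub>m ?D Y')"
        using X Y X' Y' R by (simp add: add)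
    qed (use X Y X' Y' R in auto)
  qed
qed

text \<open>The choice of \<open>R\<close> for which extending the small shift pencil gives the
  large one, so that the induction stays within shift pencils.\<close>

lemma shift_extend:
  "four_block_mat (shift_X a e) (0\<^sub>m a e) (hcat (0\<^sub>m e a) (1\<^sub>m e)) (0\<^sub>m e e) = shift_X (a + e) e"
  "four_block_mat (shift_Y a e) (0\<^sub>m a e) (0\<^sub>m e (a + e)) (1\<^sub>m e) = shift_Y (a + e) e"
  by (rule eq_matI; auto simp: shift_X_def shift_Y_def hcat_def)+

text \<open>The starting point for the induction hypothesis: the small shift pencil satisfies the
  extended predicate for every \<open>R\<close>, because for \<open>R\<close> with invertible last
  block the extension is equivalent to the large shift pencil.\<close>

lemma shift_extension_in_stable_closed:
  fixes Z :: "'a::field mat \<Rightarrow> 'a mat \<Rightarrow> bool"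
  assumes inf: "infinite (UNIV :: 'a set)" and Z: "stable_closed (a + e) (a + e + e) Z"
    and shift: "Z (shift_X (a + e) e) (shift_Y (a + e) e)" and R: "R \<in> carrier_mat e (a + e)"
  shows "Z (four_block_mat (shift_X a e) (0\<^sub>m a e) R (0\<^sub>m e e))
    (four_block_mat (shift_Y a e) (0\<^sub>m a e) (0\<^sub>m e (a + e)) (1\<^sub>m e))"
proof -
  let ?M = "a + e"
  let ?X = "shift_X a e :: 'a mat" and ?Y = "shift_Y a e :: 'a mat"
  let ?FX = "\<lambda>R. four_block_mat ?X (0\<^sub>m a e) R (0\<^sub>m e e)"
  let ?FY = "four_block_mat ?Y (0\<^sub>m a e) (0\<^sub>m e ?M) (1\<^sub>m e)"
  let ?D = "four_block_mat (0\<^sub>m a ?M) (0\<^sub>m a e) (hcat (0\<^sub>m e a) (1\<^sub>m e)) (0\<^sub>m e e)"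
  obtain R1 R2 where R12: "R1 \<in> carrier_mat e a" "R2 \<in> carrier_mat e e" "R = hcat R1 R2"
    using R by (rule carrier_mat_hcatE)
  have FXR: "?FX R \<in> carrier_mat ?M (?M + e)" and FYc: "?FY \<in> carrier_mat ?M (?M + e)"
    using R by auto
  have Dc: "?D \<in> carrier_mat ?M (?M + e)" by (intro four_block_carrier_mat) auto
  show ?thesis
  proof (rule stable_closed_line[OF Z FXR FYc Dc zero_carrier_mat infinite_det_add_smult_one[OF inf R12(2)]])
    fix t assume "t \<in> {t. det (R2 + t \<cdot>\<^sub>m 1\<^sub>m e) \<noteq> 0}"
    moreover define U where "U = R2 + t \<cdot>\<^sub>m 1\<^sub>m e"
    moreover have U: "U \<in> carrier_mat e e" using R12 by (simp add: U_def)
    ultimately have detU: "det U \<noteq> 0" by simp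
    obtain S where S: "S \<in> carrier_mat e e" "S * U = 1\<^sub>m e" "det S \<noteq> 0"
      using mat_inverse_exists[OF U detU] by auto
    have FXt: "?FX R + t \<cdot>\<^sub>m ?D = ?FX (hcat R1 U)"
      by (rule eq_matI) (use R12 in \<open>auto simp: U_def hcat_def\<close>)
    have FYt: "?FY + t \<cdot>\<^sub>m 0\<^sub>m ?M (?M + e) = ?FY"
      by (rule eq_matI) auto
    \<comment> \<open>Row operations take (R1 | U) to (0 | I): the top rows (I | 0) clear
      \<open>R1\<close>, and \<open>S\<close> inverts \<open>U\<close>. They spoil the second
      matrix, whose lower rows become \<open>- (S * (R1 * ?Y))\<close> and \<open>S\<close>.\<close>
    let ?P = "four_block_mat (1\<^sub>m a) (0\<^sub>m a e) (- (S * R1)) S"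
    \<comment> \<open>Repairs the second matrix. The first one is not affected, as its last
      \<open>e\<close> columns vanish and \<open>?Q\<close> only recombines these columns and adds
      multiples of them to the others.\<close>
    let ?Q = "four_block_mat (1\<^sub>m ?M) (0\<^sub>m ?M e) (R1 * ?Y) U"
    have RY: "R1 * ?Y \<in> carrier_mat e ?M" using R12 by auto
    have SR: "S * R1 \<in> carrier_mat e a" using S R12 by auto
    have Yc: "?Y \<in> carrier_mat a ?M" and Xc: "?X \<in> carrier_mat a ?M" by simp_all
    have J: "hcat (0\<^sub>m e a) (1\<^sub>m e :: 'a mat) \<in> carrier_mat e ?M" by auto
    have neg: "- (S * R1) \<in> carrier_mat e a" using SR by simp
    have hRU: "hcat R1 U \<in> carrier_mat e ?M" using R12 U by auto
    have "?P * ?FX (hcat R1 U) = four_block_mat (1\<^sub>m a * ?X + 0\<^sub>m a e * hcat R1 U)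
        (1\<^sub>m a * 0\<^sub>m a e + 0\<^sub>m a e * 0\<^sub>m e e) (- (S * R1) * ?X + S * hcat R1 U)
        (- (S * R1) * 0\<^sub>m a e + S * 0\<^sub>m e e)"
      by (rule mult_four_block_mat[of _ a a _ e _ e _ _ ?M _ e]) (use S SR hRU in auto)
    also have "- (S * R1) * ?X + S * hcat R1 U = hcat (0\<^sub>m e a) (1\<^sub>m e)"
    proof -
      have "- (S * R1) * ?X = hcat (- (S * R1)) (0\<^sub>m e e)"
        unfolding shift_X_eq_hcat using neg
        by (subst mult_hcat[of _ e a _ a _ e])
          (auto simp: right_mult_one_mat[OF neg] right_mult_zero_mat[OF neg])
      moreover have "S * hcat R1 U = hcat (S * R1) (1\<^sub>m e)"
        using S R12 U by (subst mult_hcat[of _ e e _ a _ e]) auto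
      moreover have "- (S * R1) + S * R1 = 0\<^sub>m e a" using SR by simp
      ultimately show ?thesis
        using SR by (simp add: hcat_add[of _ e a _ e])
    qed
    finally have PX: "?P * ?FX (hcat R1 U) = ?FX (hcat (0\<^sub>m e a) (1\<^sub>m e))"
      using S SR hRU right_mult_zero_mat[OF neg, of e] by simp
    have "?FX (hcat (0\<^sub>m e a) (1\<^sub>m e)) * ?Q = four_block_mat (?X * 1\<^sub>m ?M + 0\<^sub>m a e * (R1 * ?Y))
        (?X * 0\<^sub>m ?M e + 0\<^sub>m a e * U) (hcat (0\<^sub>m e a) (1\<^sub>m e) * 1\<^sub>m ?M + 0\<^sub>m e e * (R1 * ?Y))
        (hcat (0\<^sub>m e a) (1\<^sub>m e) * 0\<^sub>m ?M e + 0\<^sub>m e e * U)"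
      by (rule mult_four_block_mat[of _ a ?M _ e _ e _ _ ?M _ e]) (use RY U in auto)
    also have "four_block_mat (?X * 1\<^sub>m ?M + 0\<^sub>m a e * (R1 * ?Y))
        (?X * 0\<^sub>m ?M e + 0\<^sub>m a e * U) (hcat (0\<^sub>m e a) (1\<^sub>m e) * 1\<^sub>m ?M + 0\<^sub>m e e * (R1 * ?Y))
        (hcat (0\<^sub>m e a) (1\<^sub>m e) * 0\<^sub>m ?M e + 0\<^sub>m e e * U) = ?FX (hcat (0\<^sub>m e a) (1\<^sub>m e))"
      using U Xc
      by (simp add: left_mult_zero_mat[OF RY] right_mult_one_mat[OF J] right_mult_zero_mat[OF J]
        right_add_zero_mat[OF J])
    finally have PXQ: "?P * ?FX (hcat R1 U) * ?Q = shift_X ?M e"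
      using PX by (simp add: shift_extend)
    have "?P * ?FY = four_block_mat (1\<^sub>m a * ?Y + 0\<^sub>m a e * 0\<^sub>m e ?M) (1\<^sub>m a * 0\<^sub>m a e + 0\<^sub>m a e * 1\<^sub>m e)
        (- (S * R1) * ?Y + S * 0\<^sub>m e ?M) (- (S * R1) * 0\<^sub>m a e + S * 1\<^sub>m e)"
      by (rule mult_four_block_mat[of _ a a _ e _ e _ _ ?M _ e]) (use S SR in auto)
    also have "\<dots> = four_block_mat ?Y (0\<^sub>m a e) (- (S * (R1 * ?Y))) S"
      using S SR R12 Yc
      by (simp add: assoc_mult_mat[of _ e e _ a _ ?M])
    finally have PY: "?P * ?FY = four_block_mat ?Y (0\<^sub>m a e) (- (S * (R1 * ?Y))) S" .
    have SRY: "S * (R1 * ?Y) \<in> carrier_mat e ?M" using S RY by auto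
    have nSRY: "- (S * (R1 * ?Y)) \<in> carrier_mat e ?M" using SRY by simp
    have "four_block_mat ?Y (0\<^sub>m a e) (- (S * (R1 * ?Y))) S * ?Q =
        four_block_mat (?Y * 1\<^sub>m ?M + 0\<^sub>m a e * (R1 * ?Y)) (?Y * 0\<^sub>m ?M e + 0\<^sub>m a e * U)
          (- (S * (R1 * ?Y)) * 1\<^sub>m ?M + S * (R1 * ?Y)) (- (S * (R1 * ?Y)) * 0\<^sub>m ?M e + S * U)"
      by (rule mult_four_block_mat[of _ a ?M _ e _ e _ _ ?M _ e]) (use S RY U in auto)
    also have "- (S * (R1 * ?Y)) * 1\<^sub>m ?M + S * (R1 * ?Y) = 0\<^sub>m e ?M"
      unfolding right_mult_one_mat[OF nSRY] by (rule uminus_l_inv_mat[OF SRY])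
    also have "?Y * 1\<^sub>m ?M + 0\<^sub>m a e * (R1 * ?Y) = ?Y"
      by (simp add: left_mult_zero_mat[OF RY] right_mult_one_mat[OF Yc] right_add_zero_mat[OF Yc])
    also have "?Y * 0\<^sub>m ?M e + 0\<^sub>m a e * U = 0\<^sub>m a e"
      using U by (simp add: right_mult_zero_mat[OF Yc])
    also have "- (S * (R1 * ?Y)) * 0\<^sub>m ?M e + S * U = 1\<^sub>m e"
      using S U by (simp add: right_mult_zero_mat[OF nSRY])
    finally have PYQ: "?P * ?FY * ?Q = shift_Y ?M e" unfolding PY by (simp add: shift_extend)
    show "Z (?FX R + t \<cdot>\<^sub>m ?D) (?FY + t \<cdot>\<^sub>m 0\<^sub>m ?M (?M + e))"
      unfolding FXt FYt
    proof (rule stable_closed_equiv[OF Z _ FYc _ _ _ _ PXQ PYQ shift])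
      show "det ?P \<noteq> 0"
        using S SR by (subst det_four_block_mat_upper_right_zero[of _ a _ e]) auto
      show "det ?Q \<noteq> 0"
        using U detU RY by (subst det_four_block_mat_upper_right_zero[of _ ?M _ e]) auto
      show "?FX (hcat R1 U) \<in> carrier_mat ?M (?M + e)"
        by (intro four_block_carrier_mat) auto
      show "?P \<in> carrier_mat ?M ?M" "?Q \<in> carrier_mat (?M + e) (?M + e)"
        by (intro four_block_carrier_mat; use S U in auto)+
    qed
  qed
qed

text \<open>Castling: a generic pencil of size \<open>M \<times> (M + e)\<close> is equivalent to one that carries all its
  information in an \<open>(M - e) \<times> M\<close> block.\<close>

lemma stable_closed_all_step:
  fixes Z :: "'a::field mat \<Rightarrow> 'a mat \<Rightarrow> bool"
  assumes inf: "infinite (UNIV :: 'a set)" and Z: "stable_closed (a + e) (a + e + e) Z"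
    and ext: "\<And>Y. Y \<in> carrier_mat a (a + e) \<Longrightarrow> Z (shift_X (a + e) e)
      (four_block_mat Y (0\<^sub>m a e) (0\<^sub>m e (a + e)) (1\<^sub>m e))"
    and Y: "Y \<in> carrier_mat (a + e) (a + e + e)"
  shows "Z (shift_X (a + e) e) Y"
proof -
  let ?M = "a + e"
  let ?X = "shift_X ?M e :: 'a mat"
  let ?D = "four_block_mat (0\<^sub>m a ?M) (0\<^sub>m a e) (0\<^sub>m e ?M) (1\<^sub>m e) :: 'a mat"
  obtain A1 B1 A2 B2 where AB: "A1 \<in> carrier_mat a ?M" "B1 \<in> carrier_mat a e"
    "A2 \<in> carrier_mat e ?M" "B2 \<in> carrier_mat e e" "Y = four_block_mat A1 B1 A2 B2"
    using Y by (rule carrier_mat_four_block_matE)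
  have Dc: "?D \<in> carrier_mat ?M (?M + e)" by (intro four_block_carrier_mat) auto
  show ?thesis
  proof (rule stable_closed_line[OF Z shift_carrier(1) Y zero_carrier_mat Dc
        infinite_det_add_smult_one[OF inf AB(4)]])
    fix t assume "t \<in> {t. det (B2 + t \<cdot>\<^sub>m 1\<^sub>m e) \<noteq> 0}"
    moreover define U where "U = B2 + t \<cdot>\<^sub>m 1\<^sub>m e"
    moreover have U: "U \<in> carrier_mat e e" using AB by (simp add: U_def)
    ultimately have detU: "det U \<noteq> 0" by simp
    obtain S where S: "S \<in> carrier_mat e e" "S * U = 1\<^sub>m e" "det S \<noteq> 0"
      using mat_inverse_exists[OF U detU] by auto
    have Xt: "?X + t \<cdot>\<^sub>m 0\<^sub>m ?M (?M + e) = ?X"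
      by (rule eq_matI) (auto simp: shift_X_def)
    have Yt: "Y + t \<cdot>\<^sub>m ?D = four_block_mat A1 B1 A2 U"
      by (rule eq_matI) (use AB in \<open>auto simp: U_def\<close>)
    \<comment> \<open>Row operations that turn the last \<open>e\<close> columns of the second
      matrix into a zero block above an identity block; the first matrix becomes
      \<open>(?P | 0)\<close>.\<close>
    let ?P = "four_block_mat (1\<^sub>m a) (- (B1 * S)) (0\<^sub>m e a) S"
    have Pc: "?P \<in> carrier_mat ?M ?M" using S by (intro four_block_carrier_mat) auto
    have detP: "det ?P \<noteq> 0"
      using S AB by (subst det_four_block_mat_lower_left_zero[of _ a _ e]) auto
    obtain P' where P': "P' \<in> carrier_mat ?M ?M" "?P * P' = 1\<^sub>m ?M" "det P' \<noteq> 0"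
      using mat_inverse_exists[OF Pc detP] by auto
    have BS: "B1 * S \<in> carrier_mat a e" using AB S by auto
    let ?A1 = "A1 + - (B1 * S) * A2" and ?A2 = "S * A2"
    have A1: "?A1 \<in> carrier_mat a ?M" and A2: "?A2 \<in> carrier_mat e ?M"
      using AB BS S by auto
    have "?P * four_block_mat A1 B1 A2 U = four_block_mat (1\<^sub>m a * A1 + - (B1 * S) * A2)
        (1\<^sub>m a * B1 + - (B1 * S) * U) (0\<^sub>m e a * A1 + S * A2) (0\<^sub>m e a * B1 + S * U)"
      by (rule mult_four_block_mat[of _ a a _ e _ e _ _ ?M _ e]) (use AB S U BS in auto)
    also have "- (B1 * S) * U = - B1"
      using AB S U BS by (simp add: assoc_mult_mat[of _ a e _ e _ e])
    finally have PY: "?P * four_block_mat A1 B1 A2 U = four_block_mat ?A1 (0\<^sub>m a e) ?A2 (1\<^sub>m e)"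
      using AB S A2 by (simp add: add_uminus_minus_mat[OF AB(2) AB(2)])
    \<comment> \<open>\<open>P'\<close> undoes \<open>?P\<close> on the first matrix, and the lower
      left block clears \<open>?A2 * P'\<close> in the second. Only the block
      \<open>?A1 * P'\<close> remains arbitrary, which \<open>ext\<close> covers.\<close>
    let ?Q = "four_block_mat P' (0\<^sub>m ?M e) (- (?A2 * P')) (1\<^sub>m e)"
    have Qc: "?Q \<in> carrier_mat (?M + e) (?M + e)" using P' by (intro four_block_carrier_mat) auto
    have A1P: "?A1 * P' \<in> carrier_mat a ?M" and A2P: "?A2 * P' \<in> carrier_mat e ?M"
      using A1 A2 P' by auto
    have "four_block_mat ?A1 (0\<^sub>m a e) ?A2 (1\<^sub>m e) * ?Q =
        four_block_mat (?A1 * P' + 0\<^sub>m a e * - (?A2 * P')) (?A1 * 0\<^sub>m ?M e + 0\<^sub>m a e * 1\<^sub>m e)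
          (?A2 * P' + 1\<^sub>m e * - (?A2 * P')) (?A2 * 0\<^sub>m ?M e + 1\<^sub>m e * 1\<^sub>m e)"
      by (rule mult_four_block_mat[of _ a ?M _ e _ e _ _ ?M _ e]) (use A1 A2 P' A2P in auto)
    also have "0\<^sub>m a e * - (?A2 * P') = 0\<^sub>m a ?M"
      using A2P by (intro left_mult_zero_mat) auto
    also have "1\<^sub>m e * - (?A2 * P') = - (?A2 * P')"
      using A2P by (intro left_mult_one_mat) auto
    also have "?A2 * P' + - (?A2 * P') = 0\<^sub>m e ?M"
      using A2P by (simp add: add_uminus_minus_mat[OF A2P A2P])
    also have "?A1 * P' + 0\<^sub>m a ?M = ?A1 * P'" by (rule right_add_zero_mat[OF A1P])
    also have "?A1 * 0\<^sub>m ?M e + 0\<^sub>m a e * 1\<^sub>m e = 0\<^sub>m a e"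
      using right_mult_zero_mat[OF A1] by simp
    also have "?A2 * 0\<^sub>m ?M e + 1\<^sub>m e * 1\<^sub>m e = 1\<^sub>m e"
      using right_mult_zero_mat[OF A2] by simp
    finally have PYQ: "?P * four_block_mat A1 B1 A2 U * ?Q =
        four_block_mat (?A1 * P') (0\<^sub>m a e) (0\<^sub>m e ?M) (1\<^sub>m e)"
      unfolding PY .
    have "?P * ?X = hcat ?P (0\<^sub>m ?M e)"
      unfolding shift_X_eq_hcat using Pc by (subst mult_hcat[of _ ?M ?M _ ?M _ e])
        (auto simp: right_mult_one_mat[OF Pc] right_mult_zero_mat[OF Pc])
    also have "\<dots> * ?Q = hcat (?P * P' + 0\<^sub>m ?M e * - (?A2 * P')) (?P * 0\<^sub>m ?M e + 0\<^sub>m ?M e * 1\<^sub>m e)"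
      by (rule hcat_mult_four_block_mat) (use Pc P' A2P in auto)
    also have "0\<^sub>m ?M e * - (?A2 * P') = 0\<^sub>m ?M ?M"
      using A2P by (intro left_mult_zero_mat) auto
    also have "?P * 0\<^sub>m ?M e = 0\<^sub>m ?M e" by (rule right_mult_zero_mat[OF Pc])
    finally have PXQ: "?P * ?X * ?Q = ?X"
      using P'(2) by (simp add: shift_X_eq_hcat)
    show "Z (?X + t \<cdot>\<^sub>m 0\<^sub>m ?M (?M + e)) (Y + t \<cdot>\<^sub>m ?D)"
      unfolding Xt Yt
    proof (rule stable_closed_equiv[OF Z _ _ Pc detP Qc _ PXQ PYQ ext])
      show "det ?Q \<noteq> 0"
        using P' A2P by (subst det_four_block_mat_upper_right_zero[of _ ?M _ e]) auto
    qed (use A1P AB U in auto)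
  qed
qed

text \<open>\<open>Z\<close> is generalized in the induction because the hypothesis for
  \<open>m - e\<close> is applied to the predicate of \<open>stable_closed_extend\<close>, not to
  \<open>Z\<close>. Positivity of \<open>e\<close> makes the size drop.\<close>

lemma stable_closed_all:
  fixes Z :: "'a::field mat \<Rightarrow> 'a mat \<Rightarrow> bool"
  assumes inf: "infinite (UNIV :: 'a set)" and e: "0 < e"
  shows "\<lbrakk>stable_closed m (m + e) Z; Z (shift_X m e) (shift_Y m e);
    X \<in> carrier_mat m (m + e); Y \<in> carrier_mat m (m + e)\<rbrakk> \<Longrightarrow> Z X Y"
proof (induction m arbitrary: Z X Y rule: less_induct)
  case (less m)
  have "Z (shift_X m e) W" if W: "W \<in> carrier_mat m (m + e)" for W
  proof (cases "m \<le> e")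
    case True
    then show ?thesis by (rule stable_closed_all_base[OF inf less.prems(1,2) _ W])
  next
    case False
    define a where "a = m - e"
    have m: "m = a + e" and am: "a < m" using False e by (auto simp: a_def)
    note prems = less.prems(1,2)[unfolded m] W[unfolded m]
    \<comment> \<open>The hypothesis gives the extended predicate for all \<open>R\<close>; this
      instance completes \<open>shift_X a e\<close> to the large \<open>shift_X\<close>.\<close>
    have R: "hcat (0\<^sub>m e a) (1\<^sub>m e) \<in> carrier_mat e (a + e)" by auto
    show ?thesis unfolding m
    proof (rule stable_closed_all_step[OF inf prems(1) _ prems(3)])
      fix V :: "'a mat" assume V: "V \<in> carrier_mat a (a + e)"
      have "\<forall>R \<in> carrier_mat e (a + e). Z (four_block_mat (shift_X a e) (0\<^sub>m a e) R (0\<^sub>m e e))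
          (four_block_mat V (0\<^sub>m a e) (0\<^sub>m e (a + e)) (1\<^sub>m e))"
        by (rule less.IH[OF am stable_closed_extend[OF prems(1)] _ shift_carrier(1) V])
          (use shift_extension_in_stable_closed[OF inf prems(1,2)] in blast)
      from this[rule_format, OF R]
      show "Z (shift_X (a + e) e) (four_block_mat V (0\<^sub>m a e) (0\<^sub>m e (a + e)) (1\<^sub>m e))"
        unfolding shift_extend .
    qed
  qed
  then show ?case using stable_closed_all_if_shift_X[OF inf less.prems(1) _ less.prems(3,4)] by blast
qed

subsection \<open>Invariants as functions on pencils\<close>

definition pencil_point :: "'a mat \<Rightarrow> 'a mat \<Rightarrow> tvar \<Rightarrow> 'a" where
  "pencil_point X Y = (\<lambda>(i, j, k). if k = 0 then X $$ (i, j) else Y $$ (i, j))"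

definition pencil_eval :: "'a::comm_ring_1 tpoly \<Rightarrow> 'a mat \<Rightarrow> 'a mat \<Rightarrow> 'a" where
  "pencil_eval f X Y = tval (pencil_point X Y) f"

definition point_slice :: "nat \<Rightarrow> nat \<Rightarrow> nat \<Rightarrow> (tvar \<Rightarrow> 'a) \<Rightarrow> 'a mat" where
  "point_slice m n k x = mat m n (\<lambda>(i, j). x (i, j, k))"

lemma point_slice_carrier [simp]: "point_slice m n k x \<in> carrier_mat m n"
  by (simp add: point_slice_def)

lemma point_slice_pencil_point:
  assumes "X \<in> carrier_mat m n" "Y \<in> carrier_mat m n"
  shows "point_slice m n 0 (pencil_point X Y) = X" "point_slice m n (Suc 0) (pencil_point X Y) = Y"
  by (rule eq_matI; use assms in \<open>auto simp: point_slice_def pencil_point_def\<close>)+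

lemma tval_tensor_ring_cong:
  assumes f: "f \<in> tensor_ring m n"
    and eq: "\<And>i j k. i < m \<Longrightarrow> j < n \<Longrightarrow> k < 2 \<Longrightarrow> x (i, j, k) = y (i, j, k)"
  shows "tval x f = tval y f"
proof (rule tpoly_eval_cong)
  fix t v assume "t \<in> Poly_Mapping.keys f" "v \<in> Poly_Mapping.keys t"
  with f have "v \<in> tensor_vars m n" by (auto simp: tensor_ring_def)
  then show "x v = y v" by (cases v) (auto simp: tensor_vars_def intro: eq)
qed

lemma tval_eq_pencil_eval:
  assumes f: "f \<in> tensor_ring m n"
    and "\<And>i j. i < m \<Longrightarrow> j < n \<Longrightarrow> x (i, j, 0) = X $$ (i, j)"
    and "\<And>i j. i < m \<Longrightarrow> j < n \<Longrightarrow> x (i, j, 1) = Y $$ (i, j)"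
  shows "tval x f = pencil_eval f X Y"
  unfolding pencil_eval_def using assms(2,3)
  by (intro tval_tensor_ring_cong[OF f]) (auto simp: pencil_point_def less_2_cases_iff)

text \<open>Evaluation is a ring homomorphism and hence commutes with matrix products, so acting on
  the polynomial amounts to moving the point.\<close>

lemma tval_tensor_act:
  assumes f: "f \<in> tensor_ring m n" and P: "P \<in> carrier_mat m m" and Q: "Q \<in> carrier_mat n n"
  shows "tval x (tensor_act m n P Q f) = pencil_eval f
    (transpose_mat P * point_slice m n 0 x * Q) (transpose_mat P * point_slice m n 1 x * Q)"
proof -
  have val: "tval x ((transpose_mat (map_mat tconst P) * tslice m n k * map_mat tconst Q) $$ (i, j)) =
      (transpose_mat P * point_slice m n k x * Q) $$ (i, j)" if "i < m" "j < n" for i j k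
  proof -
    let ?M = "transpose_mat (map_mat tconst P) * tslice m n k * map_mat tconst Q"
    have T: "tslice m n k \<in> carrier_mat m n" by (simp add: tslice_def)
    have tP: "transpose_mat (map_mat tconst P) \<in> carrier_mat m m" using P by simp
    have tQ: "map_mat tconst Q \<in> carrier_mat n n" using Q by simp
    have "map_mat (tval x) ?M = map_mat (tval x) (transpose_mat (map_mat tconst P)) *
        map_mat (tval x) (tslice m n k) * map_mat (tval x) (map_mat tconst Q)"
      using tval.mat_hom_mult[OF mult_carrier_mat[OF tP T] tQ] tval.mat_hom_mult[OF tP T] by simp
    moreover have "map_mat (tval x) (transpose_mat (map_mat tconst P)) = transpose_mat P"
      by (rule eq_matI) auto
    moreover have "map_mat (tval x) (tslice m n k) = point_slice m n k x"
      by (rule eq_matI) (auto simp: tslice_def point_slice_def)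
    moreover have "map_mat (tval x) (map_mat tconst Q) = Q"
      by (rule eq_matI) auto
    ultimately have "map_mat (tval x) ?M = transpose_mat P * point_slice m n k x * Q" by simp
    moreover have "tval x (?M $$ (i, j)) = map_mat (tval x) ?M $$ (i, j)"
      using that P Q by (subst index_map_mat) auto
    ultimately show ?thesis by simp
  qed
  show ?thesis
    unfolding tensor_act_def tval_tsubst
    by (rule tval_eq_pencil_eval[OF f]) (simp_all add: val)
qed

lemma tensor_ring_zero_if_vanishing:
  fixes f :: "'a::idom tpoly"
  assumes "infinite (UNIV :: 'a set)" and f: "f \<in> tensor_ring m n"
    and "\<And>X Y. X \<in> carrier_mat m n \<Longrightarrow> Y \<in> carrier_mat m n \<Longrightarrow> pencil_eval f X Y = 0"
  shows "f = 0"
proof (rule tpoly_zero_if_vanishing[OF assms(1)])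
  fix x
  have "tval x f = pencil_eval f (point_slice m n 0 x) (point_slice m n 1 x)"
    by (rule tval_eq_pencil_eval[OF f]) (auto simp: point_slice_def)
  then show "tval x f = 0" by (simp add: assms(3))
qed

lemma transpose_SL: "P \<in> SL n \<Longrightarrow> transpose_mat P \<in> SL n"
  by (auto simp: SL_def det_transpose)

text \<open>Replaces an identity of polynomials by one of functions; an infinite field lets values
  determine polynomials. The transpose disappears because it permutes \<open>SL m\<close>.\<close>

lemma tensor_invariants_iff:
  fixes f :: "'a::idom tpoly"
  assumes inf: "infinite (UNIV :: 'a set)"
  shows "f \<in> tensor_invariants m n \<longleftrightarrow> f \<in> tensor_ring m n \<and>
    (\<forall>P \<in> SL m. \<forall>Q \<in> SL n. \<forall>X \<in> carrier_mat m n. \<forall>Y \<in> carrier_mat m n.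
       pencil_eval f (P * X * Q) (P * Y * Q) = pencil_eval f X Y)" (is "_ \<longleftrightarrow> _ \<and> ?inv")
proof safe
  assume f: "f \<in> tensor_invariants m n"
  then show ring: "f \<in> tensor_ring m n" by (simp add: tensor_invariants_def)
  fix P Q X Y :: "'a mat"
  assume P: "P \<in> SL m" and Q: "Q \<in> SL n" and XY: "X \<in> carrier_mat m n" "Y \<in> carrier_mat m n"
  from f transpose_SL[OF P] Q have "tensor_act m n (transpose_mat P) Q f = f"
    by (simp add: tensor_invariants_def)
  moreover have "tval (pencil_point X Y) (tensor_act m n (transpose_mat P) Q f) =
      pencil_eval f (P * X * Q) (P * Y * Q)"
    using P Q XY by (subst tval_tensor_act[OF ring]) (auto simp: SL_def point_slice_pencil_point)
  ultimately show "pencil_eval f (P * X * Q) (P * Y * Q) = pencil_eval f X Y"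
    by (simp add: pencil_eval_def)
next
  assume ring: "f \<in> tensor_ring m n" and inv: ?inv
  have "tensor_act m n P Q f = f" if P: "P \<in> SL m" and Q: "Q \<in> SL n" for P Q
  proof -
    have "tval x (tensor_act m n P Q f - f) = 0" for x
    proof -
      have "tval x (tensor_act m n P Q f) = pencil_eval f
          (transpose_mat P * point_slice m n 0 x * Q) (transpose_mat P * point_slice m n 1 x * Q)"
        using P Q by (intro tval_tensor_act[OF ring]) (auto simp: SL_def)
      also have "\<dots> = pencil_eval f (point_slice m n 0 x) (point_slice m n 1 x)"
        using inv transpose_SL[OF P] Q by auto
      also have "\<dots> = tval x f"
        by (rule tval_eq_pencil_eval[OF ring, symmetric]) (auto simp: point_slice_def)
      finally show ?thesis by (simp add: tval.hom_minus)
    qed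
    from tpoly_zero_if_vanishing[OF inf this] show ?thesis by simp
  qed
  with ring show "f \<in> tensor_invariants m n" by (simp add: tensor_invariants_def)
qed

lemma pencil_eval_path:
  fixes f :: "'a::comm_ring_1 tpoly"
  assumes f: "f \<in> tensor_ring m n"
    and "\<And>i j t. i < m \<Longrightarrow> j < n \<Longrightarrow> X t $$ (i, j) = poly (q i j) t"
    and "\<And>i j t. i < m \<Longrightarrow> j < n \<Longrightarrow> Y t $$ (i, j) = poly (r i j) t"
  obtains p where "\<And>t. poly p t = pencil_eval f (X t) (Y t)"
proof -
  obtain p where p: "\<And>t. poly p t = tval (\<lambda>v. poly (case v of (i, j, k) \<Rightarrow> if k = 0 then q i j else r i j) t) f"
    using tval_polynomial_path by blast
  have "tval (\<lambda>v. poly (case v of (i, j, k) \<Rightarrow> if k = 0 then q i j else r i j) t) f = pencil_eval f (X t) (Y t)" for t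
    by (rule tval_eq_pencil_eval[OF f]) (auto simp: assms)
  with p show ?thesis by (intro that[of p]) simp
qed

subsection \<open>Homogeneous invariants are semi-invariants of the general linear groups\<close>

definition dmat :: "nat \<Rightarrow> (nat \<Rightarrow> 'a::zero) \<Rightarrow> 'a mat" where
  "dmat k d = mat k k (\<lambda>(i, j). if i = j then d i else 0)"

lemma dmat_carrier [simp]: "dmat k d \<in> carrier_mat k k"
  by (simp add: dmat_def)

lemma det_dmat: "det (dmat k d) = (\<Prod>i<k. d i)" for d :: "nat \<Rightarrow> 'a::comm_ring_1"
proof -
  have "det (dmat k d) = prod_list (diag_mat (dmat k d))"
    by (rule det_upper_triangular[of _ k]) (auto simp: dmat_def)
  also have "diag_mat (dmat k d) = map d [0..<k]"
    by (simp add: diag_mat_def dmat_def cong: map_cong)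
  also have "prod_list (map d [0..<k]) = (\<Prod>i<k. d i)"
    by (simp add: prod.distinct_set_conv_list[symmetric] atLeast0LessThan)
  finally show ?thesis .
qed

lemma dmat_mult:
  assumes "X \<in> carrier_mat m n"
  shows "dmat m d * X = mat m n (\<lambda>(i, j). d i * X $$ (i, j))"
proof (rule eq_matI)
  fix i j assume "i < dim_row (mat m n (\<lambda>(i, j). d i * X $$ (i, j)))"
    "j < dim_col (mat m n (\<lambda>(i, j). d i * X $$ (i, j)))"
  then have ij: "i < m" "j < n" by auto
  then have "(dmat m d * X) $$ (i, j) = (\<Sum>k<m. (if i = k then d i else 0) * X $$ (k, j))"
    using assms by (auto simp: dmat_def scalar_prod_def atLeast0LessThan intro!: sum.cong)
  also have "\<dots> = (\<Sum>k<m. if i = k then d i * X $$ (k, j) else 0)"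
    by (intro sum.cong) auto
  also have "\<dots> = d i * X $$ (i, j)" using ij by simp
  finally show "(dmat m d * X) $$ (i, j) = mat m n (\<lambda>(i, j). d i * X $$ (i, j)) $$ (i, j)"
    using ij by simp
qed (use assms in \<open>auto simp: dmat_def\<close>)

lemma mult_dmat:
  fixes X :: "'a::comm_ring_1 mat"
  assumes "X \<in> carrier_mat m n"
  shows "X * dmat n d = mat m n (\<lambda>(i, j). X $$ (i, j) * d j)"
proof -
  have "transpose_mat (X * dmat n d) = transpose_mat (dmat n d) * transpose_mat X"
    by (rule transpose_mult[OF assms dmat_carrier])
  also have "transpose_mat (dmat n d) = dmat n d"
    by (rule eq_matI) (auto simp: dmat_def)
  also have "dmat n d * transpose_mat X = mat n m (\<lambda>(i, j). d i * transpose_mat X $$ (i, j))"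
    using assms by (intro dmat_mult) simp
  finally have "transpose_mat (transpose_mat (X * dmat n d)) =
      transpose_mat (mat n m (\<lambda>(i, j). d i * transpose_mat X $$ (i, j)))" by simp
  also have "\<dots> = mat m n (\<lambda>(i, j). X $$ (i, j) * d j)"
    by (rule eq_matI) (use assms in \<open>auto simp: mult.commute\<close>)
  finally show ?thesis by simp
qed

text \<open>Makes \<open>dmat k (scale_first a)\<close> the matrix diag(a, 1, ..., 1), for
  \<open>0 < k\<close> a representative of determinant \<open>a\<close> whose entries are polynomial
  in \<open>a\<close>, also at \<open>a = 0\<close>.\<close>

definition scale_first :: "'a::zero_neq_one \<Rightarrow> nat \<Rightarrow> 'a" where
  "scale_first a i = (if i = 0 then a else 1)"

lemma prod_if_first: "0 < k \<Longrightarrow> (\<Prod>i<k. if i = 0 then a else b) = a * b ^ (k - 1)"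
  for a b :: "'a::comm_monoid_mult"
  by (cases k) (simp_all add: prod.lessThan_Suc_shift del: prod.lessThan_Suc)

text \<open>Dividing diag(a, 1, ..., 1) by a scalar to reach determinant 1 needs a
  \<open>k\<close>-th root of \<open>a\<close>; hence the restriction to
  \<open>a = t ^ k\<close>.\<close>

lemma scale_first_power_eq_smult:
  fixes t :: "'a::field"
  assumes "0 < k" "t \<noteq> 0"
  obtains d where "dmat k d \<in> SL k" "\<And>i. scale_first (t ^ k) i = t * d i"
proof
  let ?d = "\<lambda>i::nat. if i = 0 then t ^ k / t else 1 / t"
  have "det (dmat k ?d) = t ^ k / t * (1 / t) ^ (k - 1)"
    unfolding det_dmat by (rule prod_if_first[OF assms(1)])
  also have "\<dots> = 1" using assms by (cases k) (simp_all add: power_one_over)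
  finally show "dmat k ?d \<in> SL k" by (simp add: SL_def)
  show "scale_first (t ^ k) i = t * ?d i" for i using assms by (simp add: scale_first_def)
qed

text \<open>The \<open>m\<close>-th powers need not fill the field, so the comparison takes place
  between polynomials in \<open>t\<close>: composing \<open>p\<close> with the \<open>m\<close>-th
  power gives a polynomial whose degree is a multiple of \<open>m\<close>, and this composition is
  injective.\<close>

lemma polynomial_in_power_is_monomial:
  fixes p :: "'a::field poly"
  assumes inf: "infinite (UNIV :: 'a set)" and m: "0 < m"
    and eq: "\<And>t. t \<noteq> 0 \<Longrightarrow> poly p (t ^ m) = t ^ N * c"
  shows "c \<noteq> 0 \<Longrightarrow> m dvd N" and "m dvd N \<Longrightarrow> poly p a = a ^ (N div m) * c"
proof -
  have inf': "infinite (UNIV - {0 :: 'a})" using inf by simp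
  let ?r = "Polynomial.monom (1::'a) m"
  have deg: "degree ?r = m" by (simp add: degree_monom_eq)
  have comp: "pcompose p ?r = Polynomial.monom c N"
    by (rule poly_eq_if_infinite_agree[OF inf']) (simp add: poly_pcompose poly_monom eq)
  show "m dvd N" if "c \<noteq> 0"
    using arg_cong[OF comp, of degree] that by (simp add: degree_pcompose deg degree_monom_eq)
       (metis dvd_triv_right)
  assume "m dvd N"
  then have N: "m * (N div m) = N" by simp
  have "pcompose (p - Polynomial.monom c (N div m)) ?r = 0"
    by (rule poly_eq_if_infinite_agree[OF inf'])
      (simp add: poly_pcompose poly_monom eq power_mult[symmetric] N)
  then have "p - Polynomial.monom c (N div m) = 0"
    using deg m by (subst (asm) pcompose_eq_0_iff) auto
  then show "poly p a = a ^ (N div m) * c" by (simp add: poly_monom)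
qed

text \<open>Homogeneity is stated through values, as the group arguments use it;
  \<open>keys_degree\<close> recovers it for monomials. The zero polynomial qualifies for every
  \<open>N\<close>, so that each component of an invariant fits.\<close>

locale homogeneous_invariant =
  fixes m n N :: nat and f :: "'a::field tpoly"
  assumes inf: "infinite (UNIV :: 'a set)" and m_pos: "0 < m" and n_pos: "0 < n"
    and ring: "f \<in> tensor_ring m n"
    and scale: "\<And>a X Y. X \<in> carrier_mat m n \<Longrightarrow> Y \<in> carrier_mat m n \<Longrightarrow>
      pencil_eval f (a \<cdot>\<^sub>m X) (a \<cdot>\<^sub>m Y) = a ^ N * pencil_eval f X Y"
    and inv: "\<And>P Q X Y. P \<in> SL m \<Longrightarrow> Q \<in> SL n \<Longrightarrow> X \<in> carrier_mat m n \<Longrightarrow>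
      Y \<in> carrier_mat m n \<Longrightarrow> pencil_eval f (P * X * Q) (P * Y * Q) = pencil_eval f X Y"
begin

lemma inv_left:
  assumes "P \<in> SL m" "X \<in> carrier_mat m n" "Y \<in> carrier_mat m n"
  shows "pencil_eval f (P * X) (P * Y) = pencil_eval f X Y"
proof -
  have "1\<^sub>m n \<in> SL n" by (simp add: SL_def)
  from inv[OF assms(1) this assms(2,3)] assms show ?thesis by (simp add: SL_def)
qed

lemma inv_right:
  assumes "Q \<in> SL n" "X \<in> carrier_mat m n" "Y \<in> carrier_mat m n"
  shows "pencil_eval f (X * Q) (Y * Q) = pencil_eval f X Y"
proof -
  have "1\<^sub>m m \<in> SL m" by (simp add: SL_def)
  from inv[OF this assms] assms show ?thesis by (simp add: SL_def)
qed

text \<open>The left side is a polynomial in \<open>a\<close>. At \<open>a = t ^ m\<close> the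
  diagonal matrix is \<open>t\<close> times one from \<open>SL m\<close>, so the value is
  \<open>t ^ N\<close> times the original one.\<close>

lemma scale_first_left:
  assumes XY: "X \<in> carrier_mat m n" "Y \<in> carrier_mat m n"
  shows "pencil_eval f X Y \<noteq> 0 \<Longrightarrow> m dvd N"
    and "m dvd N \<Longrightarrow> pencil_eval f (dmat m (scale_first a) * X) (dmat m (scale_first a) * Y) =
      a ^ (N div m) * pencil_eval f X Y"
proof -
  obtain p where p: "poly p a = pencil_eval f (dmat m (scale_first a) * X) (dmat m (scale_first a) * Y)" for a
  proof (rule pencil_eval_path[OF ring, of "\<lambda>a. dmat m (scale_first a) * X"
        "\<lambda>i j. if i = 0 then [:0, X $$ (i, j):] else [:X $$ (i, j):]" "\<lambda>a. dmat m (scale_first a) * Y"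
        "\<lambda>i j. if i = 0 then [:0, Y $$ (i, j):] else [:Y $$ (i, j):]"])
  qed (auto simp: dmat_mult[OF XY(1)] dmat_mult[OF XY(2)] scale_first_def)
  have "poly p (t ^ m) = t ^ N * pencil_eval f X Y" if t: "t \<noteq> 0" for t
  proof -
    obtain d where d: "dmat m d \<in> SL m" "\<And>i. scale_first (t ^ m) i = t * d i"
      using scale_first_power_eq_smult[OF m_pos t] by blast
    have "dmat m (scale_first (t ^ m)) * W = t \<cdot>\<^sub>m (dmat m d * W)" if "W \<in> carrier_mat m n" for W
      by (rule eq_matI) (use that in \<open>auto simp: dmat_mult d(2)\<close>)
    with p XY have "poly p (t ^ m) = pencil_eval f (t \<cdot>\<^sub>m (dmat m d * X)) (t \<cdot>\<^sub>m (dmat m d * Y))" by simp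
    also have "\<dots> = t ^ N * pencil_eval f (dmat m d * X) (dmat m d * Y)"
      by (rule scale; use XY in \<open>auto intro!: mult_carrier_mat\<close>)
    finally show ?thesis by (simp add: inv_left[OF d(1) XY])
  qed
  from polynomial_in_power_is_monomial[OF inf m_pos this]
  show "pencil_eval f X Y \<noteq> 0 \<Longrightarrow> m dvd N"
    and "m dvd N \<Longrightarrow> pencil_eval f (dmat m (scale_first a) * X) (dmat m (scale_first a) * Y) =
      a ^ (N div m) * pencil_eval f X Y"
    by (auto simp: p)
qed

lemma scale_first_right:
  assumes XY: "X \<in> carrier_mat m n" "Y \<in> carrier_mat m n"
  shows "pencil_eval f X Y \<noteq> 0 \<Longrightarrow> n dvd N"
    and "n dvd N \<Longrightarrow> pencil_eval f (X * dmat n (scale_first a)) (Y * dmat n (scale_first a)) =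
      a ^ (N div n) * pencil_eval f X Y"
proof -
  obtain p where p: "poly p a = pencil_eval f (X * dmat n (scale_first a)) (Y * dmat n (scale_first a))" for a
  proof (rule pencil_eval_path[OF ring, of "\<lambda>a. X * dmat n (scale_first a)"
        "\<lambda>i j. if j = 0 then [:0, X $$ (i, j):] else [:X $$ (i, j):]" "\<lambda>a. Y * dmat n (scale_first a)"
        "\<lambda>i j. if j = 0 then [:0, Y $$ (i, j):] else [:Y $$ (i, j):]"])
  qed (auto simp: mult_dmat[OF XY(1)] mult_dmat[OF XY(2)] scale_first_def)
  have "poly p (t ^ n) = t ^ N * pencil_eval f X Y" if t: "t \<noteq> 0" for t
  proof -
    obtain d where d: "dmat n d \<in> SL n" "\<And>i. scale_first (t ^ n) i = t * d i"
      using scale_first_power_eq_smult[OF n_pos t] by blast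
    have "W * dmat n (scale_first (t ^ n)) = t \<cdot>\<^sub>m (W * dmat n d)" if "W \<in> carrier_mat m n" for W
      by (rule eq_matI) (use that in \<open>auto simp: mult_dmat d(2)\<close>)
    with p XY have "poly p (t ^ n) = pencil_eval f (t \<cdot>\<^sub>m (X * dmat n d)) (t \<cdot>\<^sub>m (Y * dmat n d))" by simp
    also have "\<dots> = t ^ N * pencil_eval f (X * dmat n d) (Y * dmat n d)"
      by (rule scale; use XY in \<open>auto intro!: mult_carrier_mat\<close>)
    finally show ?thesis by (simp add: inv_right[OF d(1) XY])
  qed
  from polynomial_in_power_is_monomial[OF inf n_pos this]
  show "pencil_eval f X Y \<noteq> 0 \<Longrightarrow> n dvd N"
    and "n dvd N \<Longrightarrow> pencil_eval f (X * dmat n (scale_first a)) (Y * dmat n (scale_first a)) =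
      a ^ (N div n) * pencil_eval f X Y"
    by (auto simp: p)
qed

end

lemma det_scale_first: "0 < k \<Longrightarrow> det (dmat k (scale_first a)) = a" for a :: "'a::comm_ring_1"
  by (simp add: det_dmat scale_first_def prod_if_first)

lemma dmat_mult_mult_dmat:
  fixes W :: "'a::comm_ring_1 mat"
  assumes W: "W \<in> carrier_mat m n"
  shows "dmat m c * W * dmat n d = mat m n (\<lambda>(i, j). c i * W $$ (i, j) * d j)"
proof -
  have "dmat m c * W \<in> carrier_mat m n" by (rule mult_carrier_mat[OF dmat_carrier W])
  then show ?thesis by (simp add: mult_dmat) (auto simp: dmat_mult[OF W] intro!: eq_matI)
qed

lemma dmat_mult_dmat: "dmat k c * dmat k d = dmat k (\<lambda>i. c i * d i)"
  for c d :: "nat \<Rightarrow> 'a::semiring_0"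
  unfolding dmat_mult[OF dmat_carrier] by (rule eq_matI) (auto simp: dmat_def)

text \<open>Both orders are provided since \<open>P\<close> acts from the left and \<open>Q\<close>
  from the right: the diagonal factor has to stand next to the pencil, so that the factor of
  determinant 1 ends up outside and is absorbed by invariance.\<close>

lemma GL_factor:
  fixes P :: "'a::field mat"
  assumes P: "P \<in> carrier_mat k k" and "det P \<noteq> 0" "0 < k"
  shows "\<exists>S \<in> SL k. P = S * dmat k (scale_first (det P))"
    and "\<exists>S \<in> SL k. P = dmat k (scale_first (det P)) * S"
proof -
  let ?E = "dmat k (scale_first (det P))" and ?E' = "dmat k (scale_first (1 / det P))"
  have EE: "?E' * ?E = 1\<^sub>m k" "?E * ?E' = 1\<^sub>m k"
    unfolding dmat_mult_dmat by (rule eq_matI; use assms in \<open>auto simp: dmat_def scale_first_def\<close>)+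
  have "P * ?E' \<in> SL k" "?E' * P \<in> SL k"
    using assms mult_carrier_mat[OF P dmat_carrier] mult_carrier_mat[OF dmat_carrier P]
    by (auto simp: SL_def det_mult[of _ k] det_scale_first)
  moreover have "P = P * ?E' * ?E" "P = ?E * (?E' * P)"
    using P EE by (simp_all add: assoc_mult_mat[of _ k k _ k _ k] flip: assoc_mult_mat[of ?E k k ?E' k P k])
  ultimately show "\<exists>S \<in> SL k. P = S * ?E" "\<exists>S \<in> SL k. P = ?E * S" by blast+
qed

context homogeneous_invariant
begin

lemma semi_invariant:
  assumes P: "P \<in> carrier_mat m m" "det P \<noteq> 0" and Q: "Q \<in> carrier_mat n n" "det Q \<noteq> 0"
    and XY: "X \<in> carrier_mat m n" "Y \<in> carrier_mat m n" and dvd: "m dvd N" "n dvd N"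
  shows "pencil_eval f (P * X * Q) (P * Y * Q) =
    det P ^ (N div m) * det Q ^ (N div n) * pencil_eval f X Y"
proof -
  let ?E = "dmat m (scale_first (det P))" and ?F = "dmat n (scale_first (det Q))"
  obtain S where S: "S \<in> SL m" "P = S * ?E" using GL_factor(1)[OF P m_pos] by blast
  obtain T where T: "T \<in> SL n" "Q = ?F * T" using GL_factor(2)[OF Q n_pos] by blast
  have ST: "S \<in> carrier_mat m m" "T \<in> carrier_mat n n" using S T by (auto simp: SL_def)
  have PWQ: "P * W * Q = S * (?E * W * ?F) * T" if "W \<in> carrier_mat m n" for W
  proof -
    have EW: "?E * W \<in> carrier_mat m n" using that by (intro mult_carrier_mat) auto
    have "S * ?E * W = S * (?E * W)"
      by (rule assoc_mult_mat[of _ m m _ m _ n]) (use ST that in auto)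
    then have "P * W = S * (?E * W)" using S(2) by metis
    then have "P * W * Q = S * (?E * W) * (?F * T)" using T(2) by metis
    also have "\<dots> = S * (?E * W) * ?F * T"
      using ST EW by (intro assoc_mult_mat[symmetric, of _ m n _ n _ n]) auto
    also have "S * (?E * W) * ?F = S * (?E * W * ?F)"
      using ST EW by (intro assoc_mult_mat[of _ m m _ n _ n]) auto
    finally show ?thesis .
  qed
  have EXF: "?E * W \<in> carrier_mat m n" "?E * W * ?F \<in> carrier_mat m n" if "W \<in> carrier_mat m n" for W
    using that by (auto intro!: mult_carrier_mat)
  have "pencil_eval f (P * X * Q) (P * Y * Q) = pencil_eval f (?E * X * ?F) (?E * Y * ?F)"
    unfolding PWQ[OF XY(1)] PWQ[OF XY(2)] by (rule inv[OF S(1) T(1) EXF(2)[OF XY(1)] EXF(2)[OF XY(2)]])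
  also have "\<dots> = det Q ^ (N div n) * pencil_eval f (?E * X) (?E * Y)"
    by (rule scale_first_right(2)[OF EXF(1)[OF XY(1)] EXF(1)[OF XY(2)] dvd(2)])
  also have "pencil_eval f (?E * X) (?E * Y) = det P ^ (N div m) * pencil_eval f X Y"
    by (rule scale_first_left(2)[OF XY dvd(1)])
  finally show ?thesis by (simp add: mult_ac)
qed

lemma stable_closed_zeros: "stable_closed m n (\<lambda>X Y. pencil_eval f X Y = 0)"
proof (rule stable_closedI)
  fix X Y P Q
  assume XY: "X \<in> carrier_mat m n" "Y \<in> carrier_mat m n" and P: "P \<in> carrier_mat m m"
    and Q: "Q \<in> carrier_mat n n" and det: "det P \<noteq> 0" "det Q \<noteq> 0"
    and zero: "pencil_eval f (P * X * Q) (P * Y * Q) = 0"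
  show "pencil_eval f X Y = 0"
  proof (rule ccontr)
    \<comment> \<open>The character has integral exponents only if \<open>m\<close> and
      \<open>n\<close> divide \<open>N\<close>; one nonvanishing value secures this.\<close>
    assume nz: "pencil_eval f X Y \<noteq> 0"
    then have "m dvd N" "n dvd N"
      using scale_first_left(1)[OF XY] scale_first_right(1)[OF XY] by auto
    from semi_invariant[OF P det(1) Q det(2) XY this] zero det nz show False by simp
  qed
next
  fix X Y X' Y'
  assume XY: "X \<in> carrier_mat m n" "Y \<in> carrier_mat m n" "X' \<in> carrier_mat m n" "Y' \<in> carrier_mat m n"
    and zeros: "infinite {t. pencil_eval f (X + t \<cdot>\<^sub>m X') (Y + t \<cdot>\<^sub>m Y') = 0}"
  obtain p where p: "poly p t = pencil_eval f (X + t \<cdot>\<^sub>m X') (Y + t \<cdot>\<^sub>m Y')" for t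
  proof (rule pencil_eval_path[OF ring, of "\<lambda>t. X + t \<cdot>\<^sub>m X'" "\<lambda>i j. [:X $$ (i, j), X' $$ (i, j):]"
        "\<lambda>t. Y + t \<cdot>\<^sub>m Y'" "\<lambda>i j. [:Y $$ (i, j), Y' $$ (i, j):]"])
  qed (use XY in auto)
  have "p = 0" by (rule poly_eq_if_infinite_agree[OF zeros]) (simp add: p)
  then have "pencil_eval f (X + 0 \<cdot>\<^sub>m X') (Y + 0 \<cdot>\<^sub>m Y') = 0" using p[of 0] by simp
  moreover have "W + 0 \<cdot>\<^sub>m W' = W" if "W \<in> carrier_mat m n" "W' \<in> carrier_mat m n" for W W' :: "'a mat"
    by (rule eq_matI) (use that in auto)
  ultimately show "pencil_eval f X Y = 0" using XY by simp
qed

text \<open>The zero set of \<open>f\<close> is a stable closed set, so it contains all pencils as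
  soon as it contains the shift pencil.\<close>

lemma zero_if_vanishing_at_shift:
  assumes n: "n = m + e" and e: "0 < e" and zero: "pencil_eval f (shift_X m e) (shift_Y m e) = 0"
  shows "f = 0"
  by (rule tensor_ring_zero_if_vanishing[OF inf ring])
    (use stable_closed_all[where Z = "\<lambda>X Y. pencil_eval f X Y = 0", OF inf e]
      stable_closed_zeros zero n in blast)

lemma degree_dvd:
  assumes n: "n = m + e" and e: "0 < e" and "f \<noteq> 0"
  shows "m dvd N" "n dvd N"
proof -
  have "pencil_eval f (shift_X m e) (shift_Y m e) \<noteq> 0"
    using zero_if_vanishing_at_shift[OF n e] \<open>f \<noteq> 0\<close> by blast
  then show "m dvd N" "n dvd N"
    using n scale_first_left(1)[of "shift_X m e" "shift_Y m e"]
      scale_first_right(1)[of "shift_X m e" "shift_Y m e"] by auto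
qed

lemma zero_if_not_dvd:
  assumes n: "n = m + e" and e: "0 < e" and N: "0 < N" and ndvd: "\<not> e dvd m"
  shows "f = 0"
proof (rule ccontr)
  assume "f \<noteq> 0"
  then obtain u v where u: "N = m * u" and v: "N = n * v"
    using degree_dvd[OF n e] by (meson dvdE)
  have dv: "m dvd N" "n dvd N" using degree_dvd[OF n e \<open>f \<noteq> 0\<close>] by auto
  have uv: "N div m = u" "N div n = v" using m_pos n_pos by (simp add: u, simp add: v)
  let ?X = "shift_X m e :: 'a mat" and ?Y = "shift_Y m e :: 'a mat"
  have XY: "?X \<in> carrier_mat m n" "?Y \<in> carrier_mat m n" by (simp_all add: n)
  have nz: "pencil_eval f ?X ?Y \<noteq> 0"
    using zero_if_vanishing_at_shift[OF n e] \<open>f \<noteq> 0\<close> by blast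
  \<comment> \<open>Among the \<open>m + e\<close> column indices there is exactly one more multiple
    of \<open>e\<close>, namely 0 before the shift by \<open>e\<close>; hence \<open>Suc c\<close>
    in the determinant of \<open>?Q\<close>.\<close>
  define c where "c = card {i. i < m \<and> e dvd i}"
  have pow: "s ^ (c * u) = s ^ (Suc c * v)" if s: "s \<noteq> 0" for s :: 'a
  proof -
    let ?g = "\<lambda>a i. if e dvd i then a else (1::'a)"
    let ?P = "dmat m (?g s)" and ?Q = "dmat n (?g (1 / s))"
    have prod: "(\<Prod>i<m. ?g a i) = a ^ c" for a
    proof -
      have "(\<Prod>i<m. ?g a i) = (\<Prod>i\<in>{..<m} \<inter> {i. e dvd i}. a)"
        by (simp add: prod.If_cases)
      also have "\<dots> = a ^ c"
        unfolding c_def by (simp add: Int_def)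
      finally show ?thesis .
    qed
    have detP: "det ?P = s ^ c" by (simp add: det_dmat prod)
    have "det ?Q = (\<Prod>i<e + m. ?g (1 / s) i)" by (simp add: det_dmat n add.commute)
    also have "\<dots> = (\<Prod>i<e. ?g (1 / s) i) * (\<Prod>i<m. ?g (1 / s) (e + i))"
    proof -
      have "(\<Prod>i\<in>{0..<e + m}. ?g (1 / s) i) =
          (\<Prod>i\<in>{0..<e}. ?g (1 / s) i) * (\<Prod>i\<in>{e..<e + m}. ?g (1 / s) i)"
        by (rule prod.atLeastLessThan_concat[symmetric]) auto
      also have "(\<Prod>i\<in>{e..<e + m}. ?g (1 / s) i) = (\<Prod>i\<in>{0..<m}. ?g (1 / s) (e + i))"
        using prod.shift_bounds_nat_ivl[of "?g (1 / s)" 0 e m] by (simp add: add.commute)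
      finally show ?thesis by (simp add: atLeast0LessThan)
    qed
    also have "(\<Prod>i<e. ?g (1 / s) i) = (\<Prod>i<e. if i = 0 then 1 / s else 1)"
      by (intro prod.cong) (auto dest: dvd_imp_le)
    also have "\<dots> = 1 / s" using e by (simp add: prod_if_first)
    also have "(\<Prod>i<m. ?g (1 / s) (e + i)) = (1 / s) ^ c" by (simp add: prod)
    finally have detQ: "det ?Q = (1 / s) ^ Suc c" by simp
    \<comment> \<open>Nonzero entries lie at \<open>(i, i)\<close> and \<open>(i, i + e)\<close>. As
      \<open>e\<close> divides \<open>i\<close> iff it divides \<open>i + e\<close>, the factors
      \<open>s\<close> and \<open>1 / s\<close> occur together and cancel.\<close>
    have fix_X: "?P * ?X * ?Q = ?X" and fix_Y: "?P * ?Y * ?Q = ?Y"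
      unfolding dmat_mult_mult_dmat[OF XY(1)] dmat_mult_mult_dmat[OF XY(2)]
      using s by (auto simp: shift_X_def shift_Y_def n intro!: eq_matI)
    have "pencil_eval f ?X ?Y = det ?P ^ u * det ?Q ^ v * pencil_eval f ?X ?Y"
      using semi_invariant[of ?P ?Q ?X ?Y] dv XY s unfolding fix_X fix_Y uv
      by (simp add: detP detQ)
    with nz have "det ?P ^ u * det ?Q ^ v = 1" by simp
    then have "s ^ (c * u) * (1 / s) ^ (Suc c * v) = 1"
      by (simp only: detP detQ power_mult)
    then show ?thesis using s by (simp add: power_one_over field_simps)
  qed
  \<comment> \<open>Equality of powers for one \<open>s\<close> says little about the exponents;
    equality for infinitely many \<open>s\<close> makes them agree.\<close>
  have "Polynomial.monom (1::'a) (c * u) = Polynomial.monom 1 (Suc c * v)"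
    by (rule poly_eq_if_infinite_agree[of "UNIV - {0}"]) (use inf pow in \<open>auto simp: poly_monom\<close>)
  from arg_cong[OF this, of degree] have "c * u = Suc c * v" by (simp add: degree_monom_eq)
  \<comment> \<open>Eliminating \<open>u\<close> from \<open>m * u = n * v\<close> and
    \<open>c * u = Suc c * v\<close> leaves \<open>c * (m + e) = Suc c * m\<close>, that is
    \<open>m = e * c\<close>.\<close>
  have "v * (c * (m + e)) = c * (n * v)" by (simp only: n mult_ac)
  also have "\<dots> = m * (c * u)" unfolding v[symmetric] u by (simp only: mult_ac)
  also have "\<dots> = v * (Suc c * m)" unfolding \<open>c * u = Suc c * v\<close> by (simp only: mult_ac)
  finally have "v * (c * (m + e)) = v * (Suc c * m)" .
  moreover have "v \<noteq> 0" using N v by auto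
  ultimately have "c * (m + e) = Suc c * m" by simp
  then have "m = e * c" by (simp add: algebra_simps)
  with ndvd show False by simp
qed

end

section \<open>Homogeneous components of invariants\<close>

lemma hom_component_tensor_ring: "f \<in> tensor_ring m n \<Longrightarrow> hom_component k f \<in> tensor_ring m n"
  by (auto simp: tensor_ring_def keys_hom_component)

text \<open>Scaling a pencil commutes with the group action, so \<open>f\<close> agrees along the
  rays through equivalent pencils, and its components agree at these pencils.\<close>

lemma homogeneous_invariant_hom_component:
  fixes f :: "'a::field tpoly"
  assumes inf: "infinite (UNIV :: 'a set)" and "0 < m" "0 < n" and f: "f \<in> tensor_invariants m n"
  shows "homogeneous_invariant m n k (hom_component k f)"
proof
  have ring: "f \<in> tensor_ring m n"
    and inv: "\<And>P Q X Y. P \<in> SL m \<Longrightarrow> Q \<in> SL n \<Longrightarrow> X \<in> carrier_mat m n \<Longrightarrow>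
      Y \<in> carrier_mat m n \<Longrightarrow> pencil_eval f (P * X * Q) (P * Y * Q) = pencil_eval f X Y"
    using f by (auto simp: tensor_invariants_iff[OF inf])
  show comp: "hom_component k f \<in> tensor_ring m n" using ring by (rule hom_component_tensor_ring)
  have scale: "tval (\<lambda>v. a * pencil_point X Y v) g = pencil_eval g (a \<cdot>\<^sub>m X) (a \<cdot>\<^sub>m Y)"
    if "g \<in> tensor_ring m n" "X \<in> carrier_mat m n" "Y \<in> carrier_mat m n" for a X Y and g :: "'a tpoly"
    by (rule tval_eq_pencil_eval[OF that(1)]) (use that in \<open>auto simp: pencil_point_def\<close>)
  fix X Y :: "'a mat" assume XY: "X \<in> carrier_mat m n" "Y \<in> carrier_mat m n"
  show "pencil_eval (hom_component k f) (a \<cdot>\<^sub>m X) (a \<cdot>\<^sub>m Y) = a ^ k * pencil_eval (hom_component k f) X Y" for a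
    using scale[OF comp XY, of a] unfolding tval_hom_component_scale by (simp add: pencil_eval_def)
  fix P Q :: "'a mat" assume PQ: "P \<in> SL m" "Q \<in> SL n"
  then have PQc: "P \<in> carrier_mat m m" "Q \<in> carrier_mat n n" by (auto simp: SL_def)
  show "pencil_eval (hom_component k f) (P * X * Q) (P * Y * Q) = pencil_eval (hom_component k f) X Y"
    unfolding pencil_eval_def
  proof (rule tval_hom_component_eq_if_scale[OF inf])
    fix a
    have smult: "a \<cdot>\<^sub>m (P * W * Q) = P * (a \<cdot>\<^sub>m W) * Q" if "W \<in> carrier_mat m n" for W
    proof -
      have PW: "P * W \<in> carrier_mat m n" using that PQc by auto
      show ?thesis
        using mult_smult_distrib[OF PQc(1) that, of a] mult_smult_assoc_mat[OF PW PQc(2), of a] by simp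
    qed
    have PXQ: "P * X * Q \<in> carrier_mat m n" "P * Y * Q \<in> carrier_mat m n"
      using PQc XY by auto
    have "tval (\<lambda>v. a * pencil_point (P * X * Q) (P * Y * Q) v) f =
        pencil_eval f (P * (a \<cdot>\<^sub>m X) * Q) (P * (a \<cdot>\<^sub>m Y) * Q)"
      unfolding scale[OF ring PXQ] using XY by (simp add: smult)
    also have "\<dots> = pencil_eval f (a \<cdot>\<^sub>m X) (a \<cdot>\<^sub>m Y)" using XY by (intro inv PQ) auto
    finally show "tval (\<lambda>v. a * pencil_point (P * X * Q) (P * Y * Q) v) f =
        tval (\<lambda>v. a * pencil_point X Y v) f"
      by (simp add: scale[OF ring XY])
  qed
qed (use assms in auto)

subsection \<open>Kronecker products\<close>

definition kron :: "'a::times mat \<Rightarrow> 'a mat \<Rightarrow> 'a mat" where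
  "kron A P = mat (dim_row A * dim_row P) (dim_col A * dim_col P) (\<lambda>(i, j).
     A $$ (i div dim_row P, j div dim_col P) * P $$ (i mod dim_row P, j mod dim_col P))"

lemma kron_carrier [intro]:
  "A \<in> carrier_mat a b \<Longrightarrow> P \<in> carrier_mat p q \<Longrightarrow> kron A P \<in> carrier_mat (a * p) (b * q)"
  by (auto simp: kron_def)

lemma sum_div_mod: "(\<Sum>k<b * q. g (k div q) (k mod q)) = (\<Sum>x<b. \<Sum>y<q. g x y)"
  for g :: "nat \<Rightarrow> nat \<Rightarrow> 'a::comm_monoid_add"
proof -
  have "(\<Sum>k = x * q..<x * q + q. g (k div q) (k mod q)) = (\<Sum>y<q. g x y)" for x
  proof -
    have "(\<Sum>k = x * q..<x * q + q. g (k div q) (k mod q)) =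
        (\<Sum>y = 0..<q. g ((y + x * q) div q) ((y + x * q) mod q))"
      using sum.shift_bounds_nat_ivl[of "\<lambda>k. g (k div q) (k mod q)" 0 "x * q" q]
      by (simp add: add.commute)
    also have "\<dots> = (\<Sum>y<q. g x y)"
      unfolding atLeast0LessThan by (intro sum.cong) auto
    finally show ?thesis .
  qed
  then show ?thesis by (simp add: sum.nat_group[symmetric])
qed

lemma div_mod_less_mult: "(i::nat) < a * p \<Longrightarrow> i div p < a" "(i::nat) < a * p \<Longrightarrow> i mod p < p"
  by (auto simp: less_mult_imp_div_less intro!: mod_less_divisor gr0I)

lemma kron_mult:
  fixes A B P Q :: "'a::comm_semiring_0 mat"
  assumes A: "A \<in> carrier_mat a b" and B: "B \<in> carrier_mat b c"
    and P: "P \<in> carrier_mat p q" and Q: "Q \<in> carrier_mat q s"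
  shows "kron A P * kron B Q = kron (A * B) (P * Q)"
proof (rule eq_matI)
  fix i j assume "i < dim_row (kron (A * B) (P * Q))" "j < dim_col (kron (A * B) (P * Q))"
  then have ij: "i < a * p" "j < c * s" using assms by (auto simp: kron_def)
  note bounds = div_mod_less_mult[OF ij(1)] div_mod_less_mult[OF ij(2)]
  have "(kron A P * kron B Q) $$ (i, j) =
      (\<Sum>k<b * q. (A $$ (i div p, k div q) * P $$ (i mod p, k mod q)) *
        (B $$ (k div q, j div s) * Q $$ (k mod q, j mod s)))"
    using assms ij by (simp add: kron_def scalar_prod_def atLeast0LessThan)
  also have "\<dots> = (\<Sum>x<b. \<Sum>y<q. (A $$ (i div p, x) * P $$ (i mod p, y)) *
        (B $$ (x, j div s) * Q $$ (y, j mod s)))"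
    by (rule sum_div_mod)
  also have "\<dots> = (\<Sum>x<b. A $$ (i div p, x) * B $$ (x, j div s)) *
      (\<Sum>y<q. P $$ (i mod p, y) * Q $$ (y, j mod s))"
    by (simp add: sum_product mult_ac)
  also have "\<dots> = kron (A * B) (P * Q) $$ (i, j)"
    using assms ij bounds by (simp add: kron_def scalar_prod_def atLeast0LessThan)
  finally show "(kron A P * kron B Q) $$ (i, j) = kron (A * B) (P * Q) $$ (i, j)" .
qed (use assms in \<open>auto simp: kron_def\<close>)

lemma det_kron_one:
  fixes P :: "'a::idom mat"
  assumes P: "P \<in> carrier_mat p p" and p: "0 < p"
  shows "det (kron (1\<^sub>m k) P) = det P ^ k"
proof (induction k)
  case 0
  show ?case by (rule trans[OF det_dim_zero]) (auto simp: kron_def)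
next
  case (Suc k)
  have K: "kron (1\<^sub>m k) P \<in> carrier_mat (k * p) (k * p)" using P by auto
  have split: "kron (1\<^sub>m (Suc k)) P = four_block_mat (kron (1\<^sub>m k) P) (0\<^sub>m (k * p) p) (0\<^sub>m p (k * p)) P"
  proof (rule eq_matI)
    fix i j assume "i < dim_row (four_block_mat (kron (1\<^sub>m k) P) (0\<^sub>m (k * p) p) (0\<^sub>m p (k * p)) P)"
      "j < dim_col (four_block_mat (kron (1\<^sub>m k) P) (0\<^sub>m (k * p) p) (0\<^sub>m p (k * p)) P)"
    then have ij: "i < k * p + p" "j < k * p + p" using P by (auto simp: kron_def)
    have high: "x div p = k \<and> x mod p = x - k * p" if "\<not> x < k * p" "x < k * p + p" for x
    proof -
      define y where "y = x - k * p"
      have "x = k * p + y" "y < p" using that by (auto simp: y_def)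
      then show ?thesis by simp
    qed
    have low: "x div p < k" if "x < k * p" for x using that by (rule div_mod_less_mult)
    show "kron (1\<^sub>m (Suc k)) P $$ (i, j) =
        four_block_mat (kron (1\<^sub>m k) P) (0\<^sub>m (k * p) p) (0\<^sub>m p (k * p)) P $$ (i, j)"
      using P ij low[of i] low[of j] high[of i] high[of j]
      by (cases "i < k * p"; cases "j < k * p") (auto simp: kron_def)
  qed (use P in \<open>auto simp: kron_def\<close>)
  have "det (kron (1\<^sub>m (Suc k)) P) = det (kron (1\<^sub>m k) P) * det P"
    unfolding split by (rule det_four_block_mat_upper_right_zero[OF K _ _ P]) auto
  then show ?case by (simp add: Suc.IH)
qed

subsection \<open>The block determinant\<close>

text \<open>The value of the block matrix at a pencil, written with Kronecker products: the
  simultaneous action of \<open>(P, Q)\<close> on both slices then becomes multiplication by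
  \<open>kron (1\<^sub>m (Suc r)) P\<close> and \<open>kron (1\<^sub>m r) Q\<close>.\<close>

definition pencil_block_mat :: "nat \<Rightarrow> 'a::comm_ring_1 mat \<Rightarrow> 'a mat \<Rightarrow> 'a mat" where
  "pencil_block_mat r X Y = kron (mat (Suc r) r (\<lambda>(p, q). if p = q then 1 else 0)) X +
     kron (mat (Suc r) r (\<lambda>(p, q). if p = Suc q then 1 else 0)) Y"

lemma pencil_block_mat_carrier:
  assumes "X \<in> carrier_mat m n" "Y \<in> carrier_mat m n"
  shows "pencil_block_mat r X Y \<in> carrier_mat (Suc r * m) (r * n)"
  unfolding pencil_block_mat_def using assms by (intro add_carrier_mat kron_carrier) auto

lemma pencil_block_mat_index:
  assumes "X \<in> carrier_mat m n" "Y \<in> carrier_mat m n" "i < Suc r * m" "j < r * n"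
  shows "pencil_block_mat r X Y $$ (i, j) =
    (if i div m = j div n then X $$ (i mod m, j mod n)
     else if i div m = Suc (j div n) then Y $$ (i mod m, j mod n) else 0)"
  using assms div_mod_less_mult[OF assms(3)] div_mod_less_mult[OF assms(4)]
  by (auto simp: pencil_block_mat_def kron_def)

lemma pencil_block_mat_equivalence:
  assumes P: "P \<in> carrier_mat m m" and Q: "Q \<in> carrier_mat n n"
    and X: "X \<in> carrier_mat m n" and Y: "Y \<in> carrier_mat m n"
  shows "pencil_block_mat r (P * X * Q) (P * Y * Q) =
    kron (1\<^sub>m (Suc r)) P * pencil_block_mat r X Y * kron (1\<^sub>m r) Q"
proof -
  have eq: "kron (1\<^sub>m (Suc r)) P * kron S W * kron (1\<^sub>m r) Q = kron S (P * W * Q)"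
    if "S \<in> carrier_mat (Suc r) r" "W \<in> carrier_mat m n" for S W
  proof -
    have "kron (1\<^sub>m (Suc r)) P * kron S W = kron S (P * W)"
      using that P by (subst kron_mult[of _ "Suc r" "Suc r" _ r _ m m _ n]) auto
    moreover have "kron S (P * W) * kron (1\<^sub>m r) Q = kron S (P * W * Q)"
      using that P Q by (subst kron_mult[of _ "Suc r" r _ r _ m n _ n]) auto
    ultimately show ?thesis by simp
  qed
  let ?S = "mat (Suc r) r (\<lambda>(p, q). if p = q then 1 else 0)"
  let ?T = "mat (Suc r) r (\<lambda>(p, q). if p = Suc q then 1 else 0)"
  have c: "kron (1\<^sub>m (Suc r)) P \<in> carrier_mat (Suc r * m) (Suc r * m)"
    "kron (1\<^sub>m r) Q \<in> carrier_mat (r * n) (r * n)"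
    "kron ?S X \<in> carrier_mat (Suc r * m) (r * n)" "kron ?T Y \<in> carrier_mat (Suc r * m) (r * n)"
    using P Q X Y by (intro kron_carrier; auto)+
  have "kron (1\<^sub>m (Suc r)) P * (kron ?S X + kron ?T Y) * kron (1\<^sub>m r) Q =
      kron (1\<^sub>m (Suc r)) P * kron ?S X * kron (1\<^sub>m r) Q + kron (1\<^sub>m (Suc r)) P * kron ?T Y * kron (1\<^sub>m r) Q"
    using c by (simp add: mult_add_distrib_mat[OF c(1,3,4)]
        add_mult_distrib_mat[OF mult_carrier_mat[OF c(1,3)] mult_carrier_mat[OF c(1,4)] c(2)])
  then show ?thesis
    unfolding pencil_block_mat_def using X Y by (simp add: eq)
qed

lemma pencil_block_mat_smult:
  assumes "X \<in> carrier_mat m n" "Y \<in> carrier_mat m n"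
  shows "pencil_block_mat r (a \<cdot>\<^sub>m X) (a \<cdot>\<^sub>m Y) = a \<cdot>\<^sub>m pencil_block_mat r X Y"
proof (rule eq_matI)
  have c: "a \<cdot>\<^sub>m X \<in> carrier_mat m n" "a \<cdot>\<^sub>m Y \<in> carrier_mat m n" using assms by auto
  fix i j assume "i < dim_row (a \<cdot>\<^sub>m pencil_block_mat r X Y)" "j < dim_col (a \<cdot>\<^sub>m pencil_block_mat r X Y)"
  then have ij: "i < Suc r * m" "j < r * n" using pencil_block_mat_carrier[OF assms, of r] by auto
  then have "(a \<cdot>\<^sub>m pencil_block_mat r X Y) $$ (i, j) = a * pencil_block_mat r X Y $$ (i, j)"
    using pencil_block_mat_carrier[OF assms, of r] by (intro index_smult_mat) auto
  then show "pencil_block_mat r (a \<cdot>\<^sub>m X) (a \<cdot>\<^sub>m Y) $$ (i, j) = (a \<cdot>\<^sub>m pencil_block_mat r X Y) $$ (i, j)"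
    using assms div_mod_less_mult[OF ij(1)] div_mod_less_mult[OF ij(2)]
    by (simp add: pencil_block_mat_index[OF assms ij] pencil_block_mat_index[OF c ij])
qed (use pencil_block_mat_carrier[OF assms, of r] pencil_block_mat_carrier[of "a \<cdot>\<^sub>m X" m n "a \<cdot>\<^sub>m Y" r] assms
    in auto)

text \<open>A kernel vector consists of \<open>r\<close> blocks of length \<open>n\<close>. The rows of the matrix kill its first
  block up to \<open>m\<close> and its last block from \<open>d\<close> on, and relate entry \<open>i + d\<close> of a block to entry
  \<open>i\<close> of the next block; so the zeros spread from both ends and meet.\<close>

lemma det_pencil_block_mat_shift:
  assumes r: "0 < r" and d: "0 < d" and m: "m = r * d"
  shows "det (pencil_block_mat r (shift_X m d) (shift_Y m d) :: 'a::field mat) \<noteq> 0"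
proof
  define n where "n = m + d"
  let ?M = "pencil_block_mat r (shift_X m d) (shift_Y m d) :: 'a mat"
  have mn: "0 < m" "0 < n" and size: "Suc r * m = r * n"
    using r d by (auto simp: m n_def algebra_simps)
  have XY: "shift_X m d \<in> carrier_mat m n" "shift_Y m d \<in> carrier_mat m n"
    by (simp_all add: n_def)
  have M: "?M \<in> carrier_mat (r * n) (r * n)"
    using pencil_block_mat_carrier[OF XY, of r] by (simp only: size)
  assume "det ?M = 0"
  then obtain v where v: "v \<in> carrier_vec (r * n)" "v \<noteq> 0\<^sub>v (r * n)" "?M *\<^sub>v v = 0\<^sub>v (r * n)"
    using det_0_iff_vec_prod_zero_field[OF M] by blast
  define w where "w p j = v $ (p * n + j)" for p j
  \<comment> \<open>Row \<open>i\<close> of block row \<open>p\<close>. The first term is missing in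
    the last block row and the second in the first one; these two block rows supply the zeros from
    which the others spread.\<close>
  have row: "(if p < r then w p i else 0) + (if 0 < p then w (p - 1) (i + d) else 0) = 0"
    if p: "p \<le> r" and i: "i < m" for p i
  proof -
    have "p * m + i < Suc p * m" using i by simp
    also have "\<dots> \<le> Suc r * m" using p by (intro mult_le_mono1) simp
    finally have pi: "p * m + i < Suc r * m" .
    let ?e = "\<lambda>q j. if p = q then if j = i then 1 else 0
        else if p = Suc q then if j = i + d then 1 else 0 else (0::'a)"
    have "0 = (?M *\<^sub>v v) $ (p * m + i)" using v(3) pi size by simp
    also have "\<dots> = (\<Sum>c<r * n. ?M $$ (p * m + i, c) * v $ c)"
      using M v(1) pi size by (simp add: scalar_prod_def atLeast0LessThan)
    also have "\<dots> = (\<Sum>c<r * n. ?e (c div n) (c mod n) * w (c div n) (c mod n))"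
    proof (rule sum.cong[OF refl])
      fix c assume "c \<in> {..<r * n}"
      then have c: "c < r * n" by simp
      show "?M $$ (p * m + i, c) * v $ c = ?e (c div n) (c mod n) * w (c div n) (c mod n)"
      proof -
        have "c mod n < m + d" using div_mod_less_mult(2)[OF c] by (simp add: n_def)
        then have "shift_X m d $$ (i, c mod n) = (if c mod n = i then 1 else (0::'a))"
          "shift_Y m d $$ (i, c mod n) = (if c mod n = i + d then 1 else (0::'a))"
          using i by (auto simp: shift_X_def shift_Y_def)
        moreover have "(p * m + i) div m = p" "(p * m + i) mod m = i" using i by simp_all
        ultimately show ?thesis
          unfolding pencil_block_mat_index[OF XY pi c] by (simp only: w_def div_mult_mod_eq)
      qed
    qed
    also have "\<dots> = (\<Sum>q<r. \<Sum>j<n. ?e q j * w q j)" by (rule sum_div_mod)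
    also have "\<dots> = (\<Sum>q<r. (if q = p then w p i else 0) + (if Suc q = p then w (p - 1) (i + d) else 0))"
    proof (rule sum.cong[OF refl])
      fix q
      have "(\<Sum>j<n. ?e q j * w q j) = (\<Sum>j<n. if j = i then if q = p then w p i else 0 else 0) +
          (\<Sum>j<n. if j = i + d then if Suc q = p then w (p - 1) (i + d) else 0 else 0)"
        unfolding sum.distrib[symmetric] by (intro sum.cong) auto
      then show "(\<Sum>j<n. ?e q j * w q j) =
          (if q = p then w p i else 0) + (if Suc q = p then w (p - 1) (i + d) else 0)"
        using i by (simp add: n_def)
    qed
    also have "\<dots> = (if p < r then w p i else 0) + (if 0 < p then w (p - 1) (i + d) else 0)"
    proof -
      have "(\<Sum>q<r. if Suc q = p then w (p - 1) (i + d) else 0) =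
          (\<Sum>q<r. if q = p - 1 then if 0 < p then w (p - 1) (i + d) else 0 else 0)"
        by (intro sum.cong) auto
      moreover have "p - 1 < r" using p r by auto
      ultimately show ?thesis by (simp add: sum.distrib)
    qed
    finally show ?thesis by simp
  qed
  \<comment> \<open>The range of known zeros at the front shrinks by \<open>d\<close> from each
    block to the next.\<close>
  have low: "w p j = 0" if "p < r" "j < m - p * d" for p j
    using that
  proof (induction p arbitrary: j)
    case 0
    then show ?case using row[of 0 j] by simp
  next
    case (Suc p)
    then have "w p (j + d) = 0" by (intro Suc.IH) auto
    then show ?case using row[of "Suc p" j] Suc.prems by simp
  qed
  \<comment> \<open>\<open>q\<close> counts the blocks from the last one backwards; each step raises
    the start of the known zeros by \<open>d\<close>.\<close>
  have high: "w (r - Suc q) j = 0" if "q < r" "Suc q * d \<le> j" "j < n" for q j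
    using that
  proof (induction q arbitrary: j)
    case 0
    then show ?case using row[of r "j - d"] r by (simp add: n_def)
  next
    case (Suc q)
    have dj: "d \<le> j" using Suc.prems(2) by simp
    have "w (r - Suc q) (j - d) = 0"
      using Suc.prems dj by (intro Suc.IH) auto
    moreover have "(r - Suc q) - 1 = r - Suc (Suc q)" by simp
    ultimately show ?case
      using row[of "r - Suc q" "j - d"] Suc.prems dj by (simp add: n_def)
  qed
  have zero: "w p j = 0" if p: "p < r" and j: "j < n" for p j
  proof (cases "j < m - p * d")
    case False
    \<comment> \<open>This is where \<open>m = r * d\<close> enters: the zeros spreading from the
      end of block \<open>p\<close> begin exactly where those spreading from its front stop.\<close>
    have "m - p * d = (r - p) * d" by (simp add: m diff_mult_distrib)
    moreover have "r - p = Suc (r - Suc p)" "r - Suc (r - Suc p) = p" using p by auto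
    ultimately show ?thesis using high[of "r - Suc p" j] False j p by auto
  qed (use low p in blast)
  have "v $ c = 0" if "c < r * n" for c
    using zero[OF div_mod_less_mult[OF that]] by (simp add: w_def)
  with v(1) have "v = 0\<^sub>v (r * n)" by (intro eq_vecI) auto
  with v(2) show False by contradiction
qed

section \<open>Membership, degree and invariance of the block determinant\<close>

lemma is_subalgebra_tensor_ring: "is_subalgebra (tensor_ring m n)"
  unfolding is_subalgebra_def
proof (intro conjI ballI)
  show "range tconst \<subseteq> (tensor_ring m n :: 'a tpoly set)"
    by (auto simp: tensor_ring_def tconst_def split: if_splits)
  fix f g :: "'a tpoly" assume f: "f \<in> tensor_ring m n" and g: "g \<in> tensor_ring m n"
  show "f + g \<in> tensor_ring m n"
    using f g Poly_Mapping.keys_add[of f g] by (auto simp: tensor_ring_def)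
  show "f * g \<in> tensor_ring m n"
    unfolding tensor_ring_def
  proof (safe del: subsetI)
    fix t assume "t \<in> Poly_Mapping.keys (f * g)"
    then obtain a b where "t = a + b" "a \<in> Poly_Mapping.keys f" "b \<in> Poly_Mapping.keys g"
      using Poly_Mapping.keys_mult[of f g] by blast
    then show "Poly_Mapping.keys t \<subseteq> tensor_vars m n"
      using f g Poly_Mapping.keys_add[of a b] unfolding tensor_ring_def by blast
  qed
qed

lemma is_subalgebra_det:
  assumes A: "is_subalgebra A" and M: "M \<in> carrier_mat k k"
    and "\<And>i j. i < k \<Longrightarrow> j < k \<Longrightarrow> M $$ (i, j) \<in> A"
  shows "det M \<in> A"
proof -
  have const: "tconst c \<in> A" for c using A by (auto simp: is_subalgebra_def)
  have mult: "f * g \<in> A" if "f \<in> A" "g \<in> A" for f g using A that by (auto simp: is_subalgebra_def)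
  have one: "1 \<in> A" using const[of 1] by (simp add: tconst_def)
  have neg: "- 1 \<in> A" using const[of "- 1"] by (simp add: tconst_def single_uminus)
  have prod: "(\<Prod>i\<in>I. g i) \<in> A" if "\<And>i. i \<in> I \<Longrightarrow> g i \<in> A" for I :: "nat set" and g
    using that by (induction I rule: infinite_finite_induct) (auto intro: one mult)
  show ?thesis
    unfolding det_def'[OF M]
  proof (intro is_subalgebra_sum[OF A] mult prod)
    fix p assume p: "p \<in> {p. p permutes {0..<k}}"
    show "signof p \<in> A" using one neg by (auto simp: sign_def)
    fix i assume "i \<in> {0..<k}"
    with p show "M $$ (i, p i) \<in> A" using assms(3) permutes_in_image[of p "{0..<k}" i] by auto
  qed
qed

lemma tensor_block_mat_carrier: "tensor_block_mat m n d \<in> carrier_mat (n div d * m) (m div d * n)"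
  by (simp add: tensor_block_mat_def)

lemma tensor_block_det_in_tensor_ring:
  assumes size: "n div d * m = m div d * n"
  shows "(tensor_block_det m n d :: 'a::comm_ring_1 tpoly) \<in> tensor_ring m n"
  unfolding tensor_block_det_def
proof (rule is_subalgebra_det[OF is_subalgebra_tensor_ring])
  show "tensor_block_mat m n d \<in> carrier_mat (n div d * m) (n div d * m)"
    using tensor_block_mat_carrier[of m n d] by (simp add: size)
  fix i j assume ij: "i < n div d * m" "j < n div d * m"
  have "(0 :: 'a tpoly) \<in> tensor_ring m n" by (simp add: tensor_ring_def)
  moreover have "(tslice m n k $$ (i mod m, j mod n) :: 'a tpoly) \<in> tensor_ring m n" if "k < 2" for k
    using that div_mod_less_mult(2)[OF ij(1)] div_mod_less_mult(2)[of j "m div d" n] ij(2)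
    by (simp add: size tslice_def tensor_ring_def tindet_def tmonomial_def tensor_vars_def)
  ultimately show "(tensor_block_mat m n d $$ (i, j) :: 'a tpoly) \<in> tensor_ring m n"
    using ij by (simp add: tensor_block_mat_def size)
qed

lemma pencil_eval_tensor_block_det:
  assumes XY: "X \<in> carrier_mat m n" "Y \<in> carrier_mat m n" and nr: "n div d = Suc (m div d)"
  shows "pencil_eval (tensor_block_det m n d) X Y = det (pencil_block_mat (m div d) X Y)"
proof -
  let ?x = "pencil_point X Y"
  have slice: "tval ?x (tslice m n k $$ (i, j)) = (if k = 0 then X else Y) $$ (i, j)"
    if "i < m" "j < n" for i j k
    using that by (simp add: tslice_def pencil_point_def)
  have "map_mat (tval ?x) (tensor_block_mat m n d) = pencil_block_mat (m div d) X Y"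
  proof (rule eq_matI)
    have c: "pencil_block_mat (m div d) X Y \<in> carrier_mat (Suc (m div d) * m) (m div d * n)"
      by (rule pencil_block_mat_carrier[OF XY])
    fix i j assume "i < dim_row (pencil_block_mat (m div d) X Y)" "j < dim_col (pencil_block_mat (m div d) X Y)"
    then have ij: "i < Suc (m div d) * m" "j < m div d * n" using c by auto
    then have "map_mat (tval ?x) (tensor_block_mat m n d) $$ (i, j) = tval ?x (tensor_block_mat m n d $$ (i, j))"
      unfolding tensor_block_mat_def nr by (intro index_map_mat) auto
    also have "\<dots> = pencil_block_mat (m div d) X Y $$ (i, j)"
      using ij div_mod_less_mult[OF ij(1)] div_mod_less_mult[OF ij(2)]
      unfolding pencil_block_mat_index[OF XY ij] tensor_block_mat_def nr
      by (simp add: slice)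
    finally show "map_mat (tval ?x) (tensor_block_mat m n d) $$ (i, j) = pencil_block_mat (m div d) X Y $$ (i, j)" .
  qed (use pencil_block_mat_carrier[OF XY, of "m div d"] in \<open>auto simp: tensor_block_mat_def nr\<close>)
  then show ?thesis
    unfolding pencil_eval_def tensor_block_det_def tval.hom_det[symmetric] by simp
qed

lemma pencil_eval_hom:
  "pencil_eval (tconst c) X Y = c" "pencil_eval (f + g) X Y = pencil_eval f X Y + pencil_eval g X Y"
  "pencil_eval (f * g) X Y = pencil_eval f X Y * pencil_eval g X Y"
  "pencil_eval (f - g) X Y = pencil_eval f X Y - pencil_eval g X Y"
  "pencil_eval (f ^ k) X Y = pencil_eval f X Y ^ k"
  by (simp_all add: pencil_eval_def tval.hom_add tval.hom_mult tval.hom_minus tval.hom_power)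

text \<open>The group action multiplies the block matrix by Kronecker factors whose determinants are
  powers of \<open>det P\<close> and \<open>det Q\<close>, hence 1. The degree is the size of the
  matrix, \<open>Suc r * m = r * (m + d)\<close>.\<close>

lemma homogeneous_invariant_tensor_block_det:
  assumes inf: "infinite (UNIV :: 'a::field set)" and d: "0 < d" and m: "m = r * d" and r: "0 < r"
  shows "homogeneous_invariant m (m + d) (Suc r * m) (tensor_block_det m (m + d) d :: 'a tpoly)"
proof
  let ?n = "m + d"
  have div: "m div d = r" "?n div d = Suc r" using d by (simp_all add: m)
  have mn: "0 < m" "0 < ?n" and size: "Suc r * m = r * ?n"
    using r d by (auto simp: m algebra_simps)
  then show "0 < m" "0 < ?n" by auto
  show "tensor_block_det m ?n d \<in> tensor_ring m ?n"
    by (rule tensor_block_det_in_tensor_ring) (simp only: div size)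
  note eval = pencil_eval_tensor_block_det[of _ m ?n _ d, unfolded div, OF _ _ refl]
  fix X Y :: "'a mat" assume XY: "X \<in> carrier_mat m ?n" "Y \<in> carrier_mat m ?n"
  have B: "pencil_block_mat r X Y \<in> carrier_mat (Suc r * m) (Suc r * m)"
    using pencil_block_mat_carrier[OF XY, of r] by (simp only: size)
  show "pencil_eval (tensor_block_det m ?n d) (a \<cdot>\<^sub>m X) (a \<cdot>\<^sub>m Y) =
      a ^ (Suc r * m) * pencil_eval (tensor_block_det m ?n d) X Y" for a
    using XY B by (simp add: eval pencil_block_mat_smult del: mult_Suc)
  fix P Q :: "'a mat" assume "P \<in> SL m" "Q \<in> SL ?n"
  then have PQ: "P \<in> carrier_mat m m" "Q \<in> carrier_mat ?n ?n" "det P = 1" "det Q = 1"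
    by (auto simp: SL_def)
  have KP: "kron (1\<^sub>m (Suc r)) P \<in> carrier_mat (Suc r * m) (Suc r * m)" using PQ(1) by (intro kron_carrier) auto
  have KQ: "kron (1\<^sub>m r) Q \<in> carrier_mat (Suc r * m) (Suc r * m)"
    unfolding size using PQ(2) by (intro kron_carrier) auto
  have "det (pencil_block_mat r (P * X * Q) (P * Y * Q)) =
      det (kron (1\<^sub>m (Suc r)) P) * det (pencil_block_mat r X Y) * det (kron (1\<^sub>m r) Q)"
    unfolding pencil_block_mat_equivalence[OF PQ(1,2) XY]
    using det_mult[OF mult_carrier_mat[OF KP B] KQ] det_mult[OF KP B] by simp
  also have "\<dots> = det (pencil_block_mat r X Y)"
    by (simp only: det_kron_one[OF PQ(1) mn(1)] det_kron_one[OF PQ(2) mn(2)] PQ(3,4) power_one mult_1_left mult_1_right)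
  finally show "pencil_eval (tensor_block_det m ?n d) (P * X * Q) (P * Y * Q) =
      pencil_eval (tensor_block_det m ?n d) X Y"
    using PQ XY by (simp add: eval)
qed (rule inf)

context homogeneous_invariant
begin

text \<open>Comparing powers of \<open>a\<close> along rays shows that a component of degree other
  than \<open>N\<close> vanishes at every pencil. The leading monomial argument needs homogeneity of
  \<open>D\<close> in this form.\<close>

lemma keys_degree:
  assumes "t \<in> Poly_Mapping.keys f"
  shows "tmonom_degree t = N"
proof (rule ccontr)
  let ?k = "tmonom_degree t"
  assume k: "?k \<noteq> N"
  obtain M where M: "\<And>L. L \<ge> M \<Longrightarrow> f = (\<Sum>k\<le>L. hom_component k f)"
    using tpoly_eq_sum_hom_components[of f] by blast
  \<comment> \<open>Large enough for both exponents \<open>?k\<close> and \<open>N\<close> to occur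
    among the coefficients compared.\<close>
  define L where "L = M + ?k + N"
  have L: "f = (\<Sum>k\<le>L. hom_component k f)" by (rule M) (simp add: L_def)
  have "hom_component ?k f = 0"
  proof (rule tensor_ring_zero_if_vanishing[OF inf hom_component_tensor_ring[OF ring]])
    fix X Y :: "'a mat" assume XY: "X \<in> carrier_mat m n" "Y \<in> carrier_mat m n"
    let ?x = "pencil_point X Y"
    have "(\<Sum>k\<le>L. (tval ?x (hom_component k f) - (if k = N then tval ?x f else 0)) * a ^ k) = 0" for a
    proof -
      have "(\<Sum>k\<le>L. tval ?x (hom_component k f) * a ^ k) =
          tval (\<lambda>v. a * ?x v) (\<Sum>k\<le>L. hom_component k f)"
        by (simp add: tval.hom_sum tval_hom_component_scale mult.commute)
      also have "\<dots> = tval (\<lambda>v. a * ?x v) f" by (simp only: L[symmetric])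
      also have "\<dots> = pencil_eval f (a \<cdot>\<^sub>m X) (a \<cdot>\<^sub>m Y)"
        by (rule tval_eq_pencil_eval[OF ring]) (use XY in \<open>auto simp: pencil_point_def\<close>)
      also have "\<dots> = tval ?x f * a ^ N" using scale[OF XY] by (simp add: pencil_eval_def)
      also have "\<dots> = (\<Sum>k\<le>L. (if k = N then tval ?x f else 0) * a ^ k)"
        by (simp add: L_def if_distrib[of "\<lambda>c. c * _"] cong: if_cong)
      finally show ?thesis by (simp add: left_diff_distrib sum_subtractf)
    qed
    from coeffs_zero_if_infinite_zeros[OF inf this, of ?k] k
    show "pencil_eval (hom_component ?k f) X Y = 0" by (simp add: L_def pencil_eval_def)
  qed
  then have "Poly_Mapping.lookup (hom_component ?k f) t = 0" by simp
  with assms show False by (simp add: lookup_hom_component in_keys_iff)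
qed

text \<open>Two invariants of the same degree are proportional, since both are determined by their values
  at the generic pencil.\<close>

lemma eq_multiple_of_power:
  assumes n: "n = m + e" and e: "0 < e"
    and D: "homogeneous_invariant m n K D" and D0: "D \<noteq> 0" and N: "N = K * i"
  shows "\<exists>c. f = tconst c * D ^ i"
proof -
  interpret D: homogeneous_invariant m n K D by fact
  let ?F = "pencil_eval f (shift_X m e) (shift_Y m e)"
  let ?D = "pencil_eval D (shift_X m e) (shift_Y m e)"
  have nz: "?D \<noteq> 0" using D.zero_if_vanishing_at_shift[OF n e] D0 by blast
  define c where "c = ?F / ?D ^ i"
  define g where "g = f - tconst c * D ^ i"
  have sub: "is_subalgebra (tensor_ring m n :: 'a tpoly set)" by (rule is_subalgebra_tensor_ring)
  have const: "tconst a \<in> tensor_ring m n" for a :: 'a using sub by (auto simp: is_subalgebra_def)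
  have "g = f + tconst (- c) * D ^ i"
    by (simp add: g_def tconst_def single_uminus)
  moreover have "tconst (- c) * D ^ i \<in> tensor_ring m n"
    using sub const is_subalgebra_power[OF sub D.ring] unfolding is_subalgebra_def by blast
  ultimately have g: "g \<in> tensor_ring m n"
    using sub ring unfolding is_subalgebra_def by blast
  have "homogeneous_invariant m n N g"
  proof
    fix X Y :: "'a mat" assume XY: "X \<in> carrier_mat m n" "Y \<in> carrier_mat m n"
    show "pencil_eval g (a \<cdot>\<^sub>m X) (a \<cdot>\<^sub>m Y) = a ^ N * pencil_eval g X Y" for a
      using scale[OF XY, of a] D.scale[OF XY, of a]
      by (simp add: g_def pencil_eval_hom N power_mult power_mult_distrib right_diff_distrib)
    show "pencil_eval g (P * X * Q) (P * Y * Q) = pencil_eval g X Y" if "P \<in> SL m" "Q \<in> SL n" for P Q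
      using inv[OF that XY] D.inv[OF that XY] by (simp add: g_def pencil_eval_hom)
  qed (use inf m_pos n_pos g in auto)
  then interpret g: homogeneous_invariant m n N g .
  have "g = 0"
    by (rule g.zero_if_vanishing_at_shift[OF n e]) (use nz in \<open>simp add: g_def pencil_eval_hom c_def\<close>)
  then show ?thesis by (auto simp: g_def)
qed

end

section \<open>The ring of invariants in the two cases\<close>

lemma is_subalgebra_tensor_invariants:
  assumes inf: "infinite (UNIV :: 'a::idom set)"
  shows "is_subalgebra (tensor_invariants m n :: 'a tpoly set)"
  using is_subalgebra_tensor_ring[of m n, where 'a = 'a] unfolding is_subalgebra_def
  by (auto simp: tensor_invariants_iff[OF inf] pencil_eval_hom)

lemma tconst_if_hom_components_zero:
  assumes "\<And>k. 0 < k \<Longrightarrow> hom_component k f = 0"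
  shows "f \<in> range tconst"
proof
  show "f = tconst (Poly_Mapping.lookup f 0)"
  proof (rule poly_mapping_eqI)
    fix t
    show "Poly_Mapping.lookup f t = Poly_Mapping.lookup (tconst (Poly_Mapping.lookup f 0)) t"
    proof (cases "t = 0")
      case False
      then obtain v where "v \<in> Poly_Mapping.keys t" by (meson all_not_in_conv keys_eq_empty)
      then have "0 < tmonom_degree t"
        unfolding tmonom_degree_def by (intro sum_pos2[of _ v]) (auto simp: in_keys_iff)
      from arg_cong[OF assms[OF this], of "\<lambda>g. Poly_Mapping.lookup g t"] False show ?thesis
        by (simp add: lookup_hom_component tconst_def lookup_single)
    qed (simp add: tconst_def)
  qed
qed simp

lemma tensor_invariants_trivial:
  fixes m n d :: nat
  assumes inf: "infinite (UNIV :: 'k::field set)" and m: "0 < m" and mn: "m < n"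
    and d: "d = gcd m n" and nd: "n \<noteq> m + d"
  shows "(tensor_invariants m n :: 'k tpoly set) = range tconst"
proof
  define e where "e = n - m"
  have n: "n = m + e" and e: "0 < e" using mn by (auto simp: e_def)
  \<comment> \<open>The gcd of \<open>m\<close> and \<open>m + e\<close> is that of \<open>m\<close>
    and \<open>e\<close>, so if \<open>e\<close> divided \<open>m\<close> it would equal
    \<open>d\<close>, the excluded case.\<close>
  have "\<not> e dvd m"
  proof
    assume "e dvd m"
    then have "d = e" unfolding d n by (simp add: gcd_nat.absorb2)
    with nd n show False by simp
  qed
  then have "f \<in> range tconst" if "f \<in> tensor_invariants m n" for f :: "'k tpoly"
    using homogeneous_invariant.zero_if_not_dvd[OF homogeneous_invariant_hom_component[OF inf m _ that] n e] mn
    by (intro tconst_if_hom_components_zero) auto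
  then show "(tensor_invariants m n :: 'k tpoly set) \<subseteq> range tconst" by blast
  show "range tconst \<subseteq> (tensor_invariants m n :: 'k tpoly set)"
    using is_subalgebra_tensor_invariants[OF inf] by (auto simp: is_subalgebra_def)
qed

lemma tensor_invariants_generated:
  fixes m n d :: nat
  assumes inf: "infinite (UNIV :: 'k::field set)" and m: "0 < m"
    and d: "d = gcd m n" and n: "n = m + d"
  shows "is_sagbi_basis {tensor_block_det m n d} (tensor_invariants m n :: 'k tpoly set)"
    and "(tensor_invariants m n :: 'k tpoly set) = generated_algebra {tensor_block_det m n d}"
proof -
  have d0: "0 < d" using m by (simp add: d)
  obtain r where mr: "m = r * d" using d by (metis dvd_div_mult_self gcd_dvd1)
  with m have r: "0 < r" by (cases r) auto
  let ?D = "tensor_block_det m n d :: 'k tpoly" and ?K = "Suc r * m"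
  have K: "0 < ?K" using m by simp
  have D: "homogeneous_invariant m n ?K ?D"
    unfolding n by (rule homogeneous_invariant_tensor_block_det[OF inf d0 mr r])
  interpret D: homogeneous_invariant m n ?K ?D by (rule D)
  have div: "m div d = r" "n div d = Suc r" using d0 by (simp_all add: n mr)
  have "pencil_eval ?D (shift_X m d) (shift_Y m d) \<noteq> 0"
    using det_pencil_block_mat_shift[OF r d0 mr, where 'a = 'k]
    by (subst pencil_eval_tensor_block_det) (simp_all add: n[symmetric] div, simp_all add: n)
  then have D0: "?D \<noteq> 0" by (auto simp: pencil_eval_def)
  have DA: "?D \<in> tensor_invariants m n"
    using D.ring D.inv by (auto simp: tensor_invariants_iff[OF inf])
  have "\<exists>c L. f = (\<Sum>i\<le>L. tconst (c i) * ?D ^ i)" if f: "f \<in> tensor_invariants m n" for f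
  proof -
    let ?f = "\<lambda>k. hom_component k f"
    have hom: "homogeneous_invariant m n k (?f k)" for k
      by (rule homogeneous_invariant_hom_component[OF inf m _ f]) (use n m in simp)
    have "\<exists>c. \<forall>i. ?f (?K * i) = tconst (c i) * ?D ^ i"
      by (intro choice allI homogeneous_invariant.eq_multiple_of_power[OF hom n d0 D D0]) simp
    then obtain c where c: "\<And>i. ?f (?K * i) = tconst (c i) * ?D ^ i" by blast
    \<comment> \<open>A nonzero component has degree divisible by \<open>m = r * d\<close> and
      \<open>n = Suc r * d\<close>. As \<open>r\<close> and \<open>Suc r\<close> are coprime, the
      least common multiple is \<open>Suc r * m\<close>, the degree of \<open>D\<close>.\<close>
    have zero: "?f k = 0" if "\<not> ?K dvd k" for k
    proof (rule ccontr)
      assume "?f k \<noteq> 0"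
      then have "m dvd k" "n dvd k"
        using homogeneous_invariant.degree_dvd[OF hom n d0] by blast+
      then obtain a b where "k = m * a" "k = n * b" by (meson dvdE)
      then have a: "k = r * d * a" and b: "k = Suc r * d * b" by (simp_all add: n mr algebra_simps)
      then have "d * (r * a) = d * (Suc r * b)" by (simp only: mult_ac)
      then have "r * a = Suc r * b" using d0 by simp
      then have "Suc r dvd r * a" by (metis dvd_triv_left)
      moreover have "coprime (Suc r) r" by simp
      ultimately have "Suc r dvd a" by (simp add: coprime_dvd_mult_right_iff)
      then obtain x where "a = Suc r * x" by (elim dvdE)
      then have "k = ?K * x" unfolding a mr by (simp only: mult_ac)
      then have "?K dvd k" by (metis dvd_triv_left)
      with that show False by contradiction
    qed
    obtain L where L: "\<And>M. M \<ge> L \<Longrightarrow> f = (\<Sum>k\<le>M. ?f k)"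
      using tpoly_eq_sum_hom_components[of f] by blast
    \<comment> \<open>Ending the sum at a multiple of \<open>?K\<close> makes the degrees that
      survive exactly \<open>?K * i\<close> with \<open>i \<le> L\<close>.\<close>
    have "L \<le> ?K * L" using K by (cases ?K) auto
    then have "f = (\<Sum>k\<le>?K * L. ?f k)" by (rule L)
    also have "\<dots> = (\<Sum>k\<in>(\<lambda>i. ?K * i) ` {..L}. ?f k)"
      using K by (intro sum.mono_neutral_right) (auto intro!: zero elim!: dvdE)
    also have "\<dots> = (\<Sum>i\<le>L. ?f (?K * i))"
      using K by (subst sum.reindex) (auto simp: inj_on_def)
    also have "\<dots> = (\<Sum>i\<le>L. tconst (c i) * ?D ^ i)" by (simp only: c)
    finally show ?thesis by blast
  qed
  from sagbi_basis_homogeneous_generator[OF is_subalgebra_tensor_invariants[OF inf] DA D0 D.keys_degree K this]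
  show "is_sagbi_basis {?D} (tensor_invariants m n)" "tensor_invariants m n = generated_algebra {?D}"
    by auto
qed

theorem theorem3p16:
  fixes m n d :: nat
  assumes "infinite (UNIV :: 'k::field set)"
    and "0 < m" and "m < n" and "d = gcd m n"
  shows "(n = m + d \<longrightarrow>
            is_sagbi_basis {tensor_block_det m n d} (tensor_invariants m n :: 'k tpoly set) \<and>
            (tensor_invariants m n :: 'k tpoly set) = generated_algebra {tensor_block_det m n d}) \<and>
         (n \<noteq> m + d \<longrightarrow> (tensor_invariants m n :: 'k tpoly set) = range tconst)"
  using tensor_invariants_generated[OF assms(1,2,4)] tensor_invariants_trivial[OF assms] by blast

end
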